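(* Let $X$ be a reflexive complex Banach space and let $T\in\mathcal{B}(X)$ be a convex combination of products of certain type-D projections $P_1,\dots,P_N\in\mathcal{B}(X)$. Let $Z$ denote the closure of $\operatorname{Ran}(I-T)$. Then $X=\operatorname{Fix}T\oplus Z$, the projection $P_T$ onto $\operatorname{Fix}T$ along $Z$ is an orthoprojection, and for all $x\in X$ we have $$\|T^nx-P_Tx\|\to0,\quad n\to\infty.\qquad( * )$$ Moreover: (i) if $\operatorname{Ran}(I-T)$ is closed, then there exist $C>0$ and $r\in[0,1)$ such that $\|T^n-P_T\|\le Cr^n$ for all $n\ge0$; (ii) if $\operatorname{Ran}(I-T)$ is not closed, then the convergence in $( * )$ is arbitrarily slow and weakly arbitrarily slow; (iii) in either case there exists a dense subspace $X_0$ of $X$ such that for all $x\in X_0$ the convergence in $( * )$ is superpolynomially fast. Furthermore, if $\operatorname{Ran}P_k=\{x\in X:\|P_kx\|=\|x\|\}$ for $1\le k\le N$ and if all of the $N$ projections $P_1,\dots,P_N$ actually appear in the decomposition of $T$ (that is, each $P_k$ is a factor of at least one product occurring with non-zero coefficient in the convex combination), then $\operatorname{Fix}T=\operatorname{Ran}P_1\cap\dots\cap\operatorname{Ran}P_N$.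
   Context: $\mathcal{B}(X)$ is the algebra of bounded linear operators on $X$; $\operatorname{Ran}$ denotes range and $\operatorname{Fix}T=\operatorname{Ker}(I-T)$. A *projection* is $P\in\mathcal{B}(X)$ with $P^2=P$; it is an *orthoprojection* if $\|P\|\le1$. A projection $P\in\mathcal{B}(X)$ is a *type-D projection* if $P\ne0$ and there exists $r\in(0,1)$ such that $\|P-rI\|\le1-r$. Let $T_n\in\mathcal{B}(X)$, $n\ge0$, satisfy $\|T_nx\|\to0$ as $n\to\infty$ for all $x\in X$. The convergence is *arbitrarily slow* if for every sequence $(r_n)_{n\ge0}$ of non-negative scalars with $r_n\to0$ there exists $x\in X$ such that $\|T_nx\|\ge r_n$ for all $n\ge0$. It is *weakly arbitrarily slow* if for every such sequence $(r_n)_{n\ge0}$ there exist $x\in X$ and $\phi\in X^*$ such that $\operatorname{Re}\langle T_nx,\phi\rangle\ge r_n$ for all $n\ge0$, where $\langle x,\phi\rangle=\phi(x)$. It is *superpolynomially fast* for a particular $x\in X$ if $\|T_nx\|=o(n^{-k})$ as $n\to\infty$ for all $k\ge1$. For the convergence in $( * )$ these notions are applied with $T_n=T^n-P_T$. *)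

theory Defs
  imports "HOL-Analysis.Analysis" "HOL-Library.Landau_Symbols"
begin

text \<open>A complex normed space is a real normed space with a complex scalar multiplication
  that extends the real one and is compatible with the same norm.\<close>

class complex_normed_vector = real_normed_vector +
  fixes scaleC :: "complex \<Rightarrow> 'a \<Rightarrow> 'a" (infixr "*\<^sub>C" 75)
  assumes scaleC_add_right: "c *\<^sub>C (x + y) = c *\<^sub>C x + c *\<^sub>C y"
    and scaleC_add_left: "(c + d) *\<^sub>C x = c *\<^sub>C x + d *\<^sub>C x"
    and scaleC_scaleC: "c *\<^sub>C (d *\<^sub>C x) = (c * d) *\<^sub>C x"
    and scaleC_one: "1 *\<^sub>C x = x"
    and scaleR_scaleC: "r *\<^sub>R x = complex_of_real r *\<^sub>C x"
    and norm_scaleC: "norm (c *\<^sub>C x) = cmod c * norm x"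

class cbanach = complex_normed_vector + complete_space

subclass (in cbanach) banach ..

instantiation complex :: cbanach
begin

definition scaleC_complex :: "complex \<Rightarrow> complex \<Rightarrow> complex"
  where "scaleC_complex c x = c * x"

instance
  by standard (auto simp: scaleC_complex_def algebra_simps norm_mult scaleR_conv_of_real)

end

global_interpretation complex_vector:
    vector_space "scaleC :: complex \<Rightarrow> 'a \<Rightarrow> 'a::complex_normed_vector"
  defines csubspace = complex_vector.subspace
  by standard (simp_all add: scaleC_add_right scaleC_add_left scaleC_scaleC scaleC_one)

text \<open>Operators are functions; the operator norm is \<^const>\<open>onorm\<close>, which is meaningful on
  bounded operators, and \<open>T ^^ n\<close> is the \<open>n\<close>-th power. The operator norm does not depend on
  whether the scalars are real or complex.\<close>

definition bounded_clinear ::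
    "('a::complex_normed_vector \<Rightarrow> 'b::complex_normed_vector) \<Rightarrow> bool"
  where "bounded_clinear f \<longleftrightarrow> bounded_linear f \<and> (\<forall>c x. f (c *\<^sub>C x) = c *\<^sub>C f x)"

definition cdual :: "('a::complex_normed_vector \<Rightarrow> complex) set"
  where "cdual = {\<phi>. bounded_clinear \<phi>}"

text \<open>The dual is a set of functions rather than a type, so elements of the bidual are
  functionals of which only the values on \<^const>\<open>cdual\<close> matter.\<close>

definition cbidual :: "(('a::complex_normed_vector \<Rightarrow> complex) \<Rightarrow> complex) set"
  where "cbidual = {F.
    (\<forall>\<phi>\<in>cdual. \<forall>\<psi>\<in>cdual. F (\<lambda>x. \<phi> x + \<psi> x) = F \<phi> + F \<psi>) \<and>
    (\<forall>c. \<forall>\<phi>\<in>cdual. F (\<lambda>x. c * \<phi> x) = c * F \<phi>) \<and>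
    (\<exists>M. \<forall>\<phi>\<in>cdual. cmod (F \<phi>) \<le> M * onorm \<phi>)}"

text \<open>Surjectivity of the canonical embedding into the bidual.\<close>

definition reflexive_space :: "'a::complex_normed_vector itself \<Rightarrow> bool"
  where "reflexive_space _ \<longleftrightarrow>
    (\<forall>F \<in> (cbidual :: (('a \<Rightarrow> complex) \<Rightarrow> complex) set). \<exists>x. \<forall>\<phi>\<in>cdual. F \<phi> = \<phi> x)"

definition projection :: "('a::complex_normed_vector \<Rightarrow> 'a) \<Rightarrow> bool"
  where "projection P \<longleftrightarrow> bounded_clinear P \<and> P \<circ> P = P"

definition orthoprojection :: "('a::complex_normed_vector \<Rightarrow> 'a) \<Rightarrow> bool"
  where "orthoprojection P \<longleftrightarrow> projection P \<and> onorm P \<le> 1"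

definition type_D_projection :: "('a::complex_normed_vector \<Rightarrow> 'a) \<Rightarrow> bool"
  where "type_D_projection P \<longleftrightarrow> projection P \<and> P \<noteq> (\<lambda>x. 0) \<and>
    (\<exists>r. 0 < r \<and> r < 1 \<and> onorm (\<lambda>x. P x - r *\<^sub>R x) \<le> 1 - r)"

definition Fix :: "('a \<Rightarrow> 'a) \<Rightarrow> 'a set"
  where "Fix T = {x. T x = x}"

definition word_product :: "(nat \<Rightarrow> 'a \<Rightarrow> 'a) \<Rightarrow> nat list \<Rightarrow> 'a \<Rightarrow> 'a"
  where "word_product P w = foldr (\<circ>) (map P w) id"

definition direct_sum_decomposition :: "'a::complex_normed_vector set \<Rightarrow> 'a set \<Rightarrow> bool"
  where "direct_sum_decomposition A B \<longleftrightarrow> csubspace A \<and> csubspace B \<and>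
    A \<inter> B = {0} \<and> (\<forall>x. \<exists>a\<in>A. \<exists>b\<in>B. x = a + b)"

text \<open>Only meaningful if \<open>A\<close> and \<open>B\<close> form a direct sum decomposition of the space.\<close>

definition projection_along :: "'a::complex_normed_vector set \<Rightarrow> 'a set \<Rightarrow> 'a \<Rightarrow> 'a"
  where "projection_along A B x = (THE a. a \<in> A \<and> x - a \<in> B)"

definition arbitrarily_slow :: "(nat \<Rightarrow> 'a::complex_normed_vector \<Rightarrow> 'a) \<Rightarrow> bool"
  where "arbitrarily_slow S \<longleftrightarrow>
    (\<forall>r :: nat \<Rightarrow> real. (\<forall>n. 0 \<le> r n) \<and> r \<longlonglongrightarrow> 0 \<longrightarrow> (\<exists>x. \<forall>n. norm (S n x) \<ge> r n))"

definition weakly_arbitrarily_slow :: "(nat \<Rightarrow> 'a::complex_normed_vector \<Rightarrow> 'a) \<Rightarrow> bool"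
  where "weakly_arbitrarily_slow S \<longleftrightarrow>
    (\<forall>r :: nat \<Rightarrow> real. (\<forall>n. 0 \<le> r n) \<and> r \<longlonglongrightarrow> 0 \<longrightarrow>
      (\<exists>x. \<exists>\<phi>\<in>cdual. \<forall>n. Re (\<phi> (S n x)) \<ge> r n))"

definition superpolynomially_fast_at ::
    "(nat \<Rightarrow> 'a::complex_normed_vector \<Rightarrow> 'a) \<Rightarrow> 'a \<Rightarrow> bool"
  where "superpolynomially_fast_at S x \<longleftrightarrow>
    (\<forall>k::nat. k \<ge> 1 \<longrightarrow> (\<lambda>n. norm (S n x)) \<in> o(\<lambda>n. 1 / real n ^ k))"

end

theory Submission
  imports Defs
begin

text \<open>Each type-D projection is a convex combination \<open>r I + (1 - r) S\<close> of the identity and a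
  contraction, and this form is inherited by products and convex combinations. Hence
  \<open>T = \<rho> I + (1 - \<rho>) S\<close>, and binomial expansion gives \<open>\<parallel>T\<^sup>n (I - T)\<parallel> = O(1 / sqrt n)\<close>. Thus
  \<open>T\<^sup>n\<close> tends to \<open>0\<close> strongly on the closure \<open>Z\<close> of the range of \<open>I - T\<close>, and reflexivity yields
  \<open>X = Fix T \<oplus> Z\<close>. If \<open>I - T\<close> is bounded below on \<open>Z\<close>, then the decay is exponential and the range
  is closed. Otherwise \<open>Z\<close> contains approximate eigenvectors \<open>x\<^sub>k\<close> for the eigenvalue \<open>1\<close> with
  matching approximate eigenfunctionals \<open>\<phi>\<^sub>k\<close> of the adjoint; they can be chosen almost
  biorthogonal along the whole orbit, and \<open>x = \<Sum> \<theta>\<^sup>k x\<^sub>k\<close>, \<open>\<phi> = \<Sum> \<theta>\<^sup>k \<phi>\<^sub>k\<close> with \<open>\<theta>\<close> close to \<open>1\<close>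
  satisfy \<open>Re \<phi>(T\<^sup>n x) \<ge> r\<^sub>n\<close>: the scales that have not yet decayed outweigh the one that is
  decaying. The same orbits show that the range is not closed in this case. Superpolynomial
  decay holds on \<open>Fix T\<close> plus the common range of all powers of \<open>I - T\<close>.\<close>

subsection \<open>The Hahn-Banach theorem\<close>

definition sublinear :: "('a::real_vector \<Rightarrow> real) \<Rightarrow> bool"
  where "sublinear p \<longleftrightarrow>
    (\<forall>x y. p (x + y) \<le> p x + p y) \<and> (\<forall>c x. 0 \<le> c \<longrightarrow> p (c *\<^sub>R x) = c * p x)"

text \<open>The inequality for \<open>c\<close> and the one for \<open>inverse c\<close> together
  give equality, so one direction of homogeneity suffices.\<close>

lemma sublinearI:
  assumes add: "\<And>x y. p (x + y) \<le> p x + p y"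
    and zero: "p 0 = 0"
    and scale: "\<And>c x. 0 < c \<Longrightarrow> p (c *\<^sub>R x) \<le> c * p x"
  shows "sublinear p"
  unfolding sublinear_def
proof (intro conjI allI impI add)
  fix c :: real and x
  assume "0 \<le> c"
  show "p (c *\<^sub>R x) = c * p x"
  proof (cases "c = 0")
    case False
    with \<open>0 \<le> c\<close> have "0 < c" by simp
    then have "p x \<le> inverse c * p (c *\<^sub>R x)"
      using scale[of "inverse c" "c *\<^sub>R x"] by simp
    with \<open>0 < c\<close> have "c * p x \<le> p (c *\<^sub>R x)" by (simp add: field_simps)
    with scale[OF \<open>0 < c\<close>, of x] show ?thesis by simp
  qed (simp add: zero)
qed

lemma sublinear_add: "sublinear p \<Longrightarrow> p (x + y) \<le> p x + p y"
  and sublinear_scale: "sublinear p \<Longrightarrow> 0 \<le> c \<Longrightarrow> p (c *\<^sub>R x) = c * p x"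
  by (simp_all add: sublinear_def)

lemma sublinear_zero: "sublinear p \<Longrightarrow> p 0 = 0"
  using sublinear_scale[of p 0 0] by simp

lemma sublinear_minus: "sublinear p \<Longrightarrow> - p (- x) \<le> p x"
  using sublinear_add[of p x "- x"] sublinear_zero[of p] by simp

text \<open>A sublinear functional can be lowered until it is linear along a given vector;
  hence the minimal sublinear functionals are the linear ones.\<close>

lemma sublinear_lower:
  assumes p: "sublinear p"
  obtains q where "sublinear q" "\<And>x. q x \<le> p x" "q (- y) \<le> - p y"
    "\<And>x. q x \<le> p (x + y) - p y"
proof -
  \<comment> \<open>The infimum over \<open>t\<close> is finite because of the lower bound
    \<open>- p (- x)\<close>. Taking \<open>t = 0\<close> puts \<open>q\<close> below
    \<open>p\<close>, and \<open>t = 1\<close> gives both additional bounds.\<close>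
  define g where "g = (\<lambda>x t. p (x + t *\<^sub>R y) - t * p y)"
  define q where "q = (\<lambda>x. INF t\<in>{0..}. g x t)"
  have g_ge: "- p (- x) \<le> g x t" if "0 \<le> t" for x t
    using sublinear_add[OF p, of "x + t *\<^sub>R y" "- x"] sublinear_scale[OF p that, of y]
    by (simp add: g_def)
  have bdd: "bdd_below (g x ` {0..})" for x
    using g_ge by (auto intro!: bdd_belowI2[of _ "- p (- x)"])
  have q_le: "q x \<le> g x t" if "0 \<le> t" for x t
    unfolding q_def using bdd that by (auto intro: cINF_lower)
  have q_ge: "a \<le> q x" if "\<And>t. 0 \<le> t \<Longrightarrow> a \<le> g x t" for a x
    unfolding q_def using that by (auto intro: cINF_greatest)
  have "sublinear q"
  proof (rule sublinearI)
    fix x x'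
    have "q (x + x') - g x s \<le> g x' t" if "0 \<le> s" "0 \<le> t" for s t
    proof -
      have "q (x + x') \<le> g (x + x') (s + t)" using that by (intro q_le) simp
      also have "\<dots> \<le> g x s + g x' t"
        using sublinear_add[OF p, of "x + s *\<^sub>R y" "x' + t *\<^sub>R y"]
        by (simp add: g_def algebra_simps)
      finally show ?thesis by simp
    qed
    then have "q (x + x') - q x' \<le> g x s" if "0 \<le> s" for s
      using q_ge[of "q (x + x') - g x s" x'] that by fastforce
    then have "q (x + x') - q x' \<le> q x" by (rule q_ge)
    then show "q (x + x') \<le> q x + q x'" by simp
  next
    have "0 \<le> q 0" by (rule q_ge) (simp add: g_def sublinear_scale[OF p])
    moreover have "q 0 \<le> 0" using q_le[of 0 0] by (simp add: g_def sublinear_zero[OF p])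
    ultimately show "q 0 = 0" by simp
  next
    fix c :: real and x
    assume c: "0 < c"
    have "q (c *\<^sub>R x) / c \<le> g x t" if "0 \<le> t" for t
    proof -
      have "q (c *\<^sub>R x) \<le> g (c *\<^sub>R x) (c * t)" using c that by (intro q_le) simp
      also have "\<dots> = c * g x t"
        using sublinear_scale[OF p, of c "x + t *\<^sub>R y"] c
        by (simp add: g_def algebra_simps)
      finally show ?thesis using c by (simp add: field_simps)
    qed
    then have "q (c *\<^sub>R x) / c \<le> q x" by (rule q_ge)
    then show "q (c *\<^sub>R x) \<le> c * q x" using c by (simp add: field_simps)
  qed
  moreover have "q x \<le> p x" for x using q_le[of 0 x] by (simp add: g_def)
  moreover have "q (- y) \<le> - p y"
    using q_le[of 1 "- y"] by (simp add: g_def sublinear_zero[OF p])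
  moreover have "q x \<le> p (x + y) - p y" for x using q_le[of 1 x] by (simp add: g_def)
  ultimately show ?thesis using that by blast
qed

lemma minimal_sublinear_exists:
  assumes p: "sublinear p"
  obtains q where "sublinear q" "\<And>x. q x \<le> p x"
    "\<And>q'. sublinear q' \<Longrightarrow> (\<And>x. q' x \<le> q x) \<Longrightarrow> q' = q"
proof -
  define A where "A = {q. sublinear q \<and> (\<forall>x. q x \<le> p x)}"
  \<comment> \<open>The pointwise order is reversed, so that maximal elements in Zorn's lemma are
    minimal functionals; a chain is bounded by its pointwise infimum.\<close>
  define above where "above = (\<lambda>q q' :: 'a \<Rightarrow> real. \<forall>x. q' x \<le> q x)"
  have "\<exists>m\<in>A. \<forall>a\<in>A. above m a \<longrightarrow> a = m"
  proof (rule predicate_Zorn)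
    show "partial_order_on A (relation_of above A)"
      by (rule partial_order_on_relation_ofI)
        (auto simp: above_def fun_eq_iff intro: order_trans order_antisym)
  next
    fix \<C> assume "\<C> \<in> Chains (relation_of above A)"
    then have C: "\<forall>q\<in>\<C>. \<forall>q'\<in>\<C>. q \<in> A \<and> (above q q' \<or> above q' q)"
      unfolding Chains_def relation_of_def by blast
    have CA: "q \<in> A" if "q \<in> \<C>" for q using C that by blast
    have total: "above q q' \<or> above q' q" if "q \<in> \<C>" "q' \<in> \<C>" for q q'
      using C that by blast
    show "\<exists>u\<in>A. \<forall>a\<in>\<C>. above a u"
    proof (cases "\<C> = {}")
      case True
      then show ?thesis using p by (auto simp: A_def)
    next
      case False
      define u where "u = (\<lambda>x. INF q\<in>\<C>. q x)"
      have "- p (- x) \<le> q x" if "q \<in> \<C>" for q x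
        using CA[OF that] sublinear_minus[of q x] unfolding A_def
        by (smt (verit, best) mem_Collect_eq)
      then have bdd: "bdd_below ((\<lambda>q. q x) ` \<C>)" for x
        by (auto intro!: bdd_belowI2[of _ "- p (- x)"])
      have u_le: "u x \<le> q x" if "q \<in> \<C>" for q x
        unfolding u_def using bdd that by (auto intro: cINF_lower)
      have u_ge: "a \<le> u x" if "\<And>q. q \<in> \<C> \<Longrightarrow> a \<le> q x" for a x
        unfolding u_def using that False by (auto intro: cINF_greatest)
      have "sublinear u"
      proof (rule sublinearI)
        fix x y
        have "u (x + y) - q x \<le> q' y" if q: "q \<in> \<C>" "q' \<in> \<C>" for q q'
        proof -
          \<comment> \<open>In a chain the smaller of \<open>q\<close> and \<open>q'\<close> lies
            below both, so a single subadditive \<open>h\<close> serves both arguments.\<close>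
          obtain h where h: "h \<in> \<C>" "h x \<le> q x" "h y \<le> q' y"
            using total[OF q] q unfolding above_def by blast
          then have "u (x + y) \<le> h x + h y"
            using u_le[OF h(1), of "x + y"] CA[OF h(1)] sublinear_add[of h x y]
            by (simp add: A_def)
          with h show ?thesis by simp
        qed
        then have "u (x + y) - u y \<le> q x" if "q \<in> \<C>" for q
          using u_ge[of "u (x + y) - q x" y] that by fastforce
        then have "u (x + y) - u y \<le> u x" by (rule u_ge)
        then show "u (x + y) \<le> u x + u y" by simp
      next
        have "q 0 = 0" if "q \<in> \<C>" for q using CA[OF that] by (simp add: A_def sublinear_zero)
        then have "(\<lambda>q. q 0) ` \<C> = {0}" using False by force
        then show "u 0 = 0" by (simp add: u_def)
      next
        fix c :: real and x
        assume c: "0 < c"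
        have "u (c *\<^sub>R x) / c \<le> q x" if "q \<in> \<C>" for q
          using u_le[OF that, of "c *\<^sub>R x"] CA[OF that] c sublinear_scale[of q c x]
          by (simp add: A_def field_simps)
        then have "u (c *\<^sub>R x) / c \<le> u x" by (rule u_ge)
        then show "u (c *\<^sub>R x) \<le> c * u x" using c by (simp add: field_simps)
      qed
      moreover have "u x \<le> p x" for x
        using False u_le CA unfolding A_def by (blast intro: order_trans)
      ultimately show ?thesis using u_le by (auto simp: A_def above_def)
    qed
  qed
  then obtain q where q: "q \<in> A" "\<And>a. a \<in> A \<Longrightarrow> above q a \<Longrightarrow> a = q" by blast
  have "q' = q" if q': "sublinear q'" "\<And>x. q' x \<le> q x" for q'
  proof (rule q(2))
    show "q' \<in> A" using q(1) q' unfolding A_def by (blast intro: order_trans)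
    show "above q q'" using q'(2) by (simp add: above_def)
  qed
  with q(1) that show ?thesis by (auto simp: A_def)
qed

text \<open>Lowering \<open>p\<close> along \<open>y\<close> first forces
  \<open>f (- y) \<le> - p y\<close>, which turns into \<open>f y = p y\<close> once a minimal
  \<open>f\<close> is known to be linear.\<close>

theorem hahn_banach_sublinear:
  assumes p: "sublinear p"
  obtains f where "linear f" "\<And>x. f x \<le> p x" "f y = p y"
proof -
  obtain p' where p': "sublinear p'" "\<And>x. p' x \<le> p x" "p' (- y) \<le> - p y"
    using sublinear_lower[OF p, of y] by metis
  obtain f where f: "sublinear f" "\<And>x. f x \<le> p' x"
    and minimal: "\<And>q. sublinear q \<Longrightarrow> (\<And>x. q x \<le> f x) \<Longrightarrow> q = f"
    using minimal_sublinear_exists[OF p'(1)] by metis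
  have add: "f (x + z) = f x + f z" for x z
  proof -
    obtain q where q: "sublinear q" "\<And>x. q x \<le> f x" "\<And>x. q x \<le> f (x + z) - f z"
      using sublinear_lower[OF f(1), of z] by metis
    \<comment> \<open>Minimality gives \<open>q = f\<close>, so the third bound on \<open>q\<close>
      becomes superadditivity of \<open>f\<close>.\<close>
    from minimal[OF q(1,2)] q(3)[of x] sublinear_add[OF f(1), of x z] show ?thesis by simp
  qed
  have minus: "f (- x) = - f x" for x
    using add[of x "- x"] sublinear_zero[OF f(1)] by simp
  have "linear f"
  proof (rule linearI[OF add])
    fix c :: real and x
    show "f (c *\<^sub>R x) = c *\<^sub>R f x"
    proof (cases "0 \<le> c")
      case True
      then show ?thesis by (simp add: sublinear_scale[OF f(1)])
    next
      case False
      then show ?thesis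
        using sublinear_scale[OF f(1), of "- c" x] minus[of "c *\<^sub>R x"] by simp
    qed
  qed
  moreover have "f x \<le> p x" for x using f(2) p'(2) order_trans by blast
  moreover have "f y = p y"
    using f(2)[of "- y"] p'(3) minus[of y] \<open>f y \<le> p y\<close> by simp
  ultimately show ?thesis using that by blast
qed

subsection \<open>Complex normed spaces\<close>

lemma bounded_clinear_bounded_linear: "bounded_clinear f \<Longrightarrow> bounded_linear f"
  and bounded_clinear_scaleC: "bounded_clinear f \<Longrightarrow> f (c *\<^sub>C x) = c *\<^sub>C f x"
  by (simp_all add: bounded_clinear_def)

lemma bounded_clinear_compose:
  "bounded_clinear f \<Longrightarrow> bounded_clinear g \<Longrightarrow> bounded_clinear (\<lambda>x. f (g x))"
  by (simp add: bounded_clinear_def bounded_linear_compose)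

lemma bounded_clinear_add:
  "bounded_clinear f \<Longrightarrow> bounded_clinear g \<Longrightarrow> bounded_clinear (\<lambda>x. f x + g x)"
  by (simp add: bounded_clinear_def bounded_linear_add scaleC_add_right)

lemma bounded_linear_cdual: "\<phi> \<in> cdual \<Longrightarrow> bounded_linear \<phi>"
  by (simp add: cdual_def bounded_clinear_def)

lemma scaleC_scaleR_commute: "c *\<^sub>C (r *\<^sub>R x) = r *\<^sub>R (c *\<^sub>C x)"
  by (simp add: scaleR_scaleC scaleC_scaleC mult.commute)

lemma scaleC_zero: "c *\<^sub>C 0 = (0 :: 'a::complex_normed_vector)"
  using scaleC_scaleR_commute[of c 0 0] by simp

lemma scaleC_minus: "c *\<^sub>C (- x) = - (c *\<^sub>C x)"
  using scaleC_scaleR_commute[of c "-1" x] by simp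

lemma scaleC_diff: "c *\<^sub>C (x - y) = c *\<^sub>C x - c *\<^sub>C y"
  using scaleC_add_right[of c x "- y"] by (simp add: scaleC_minus)

lemma bounded_clinear_scaleR:
  "bounded_clinear f \<Longrightarrow> bounded_clinear (\<lambda>x. r *\<^sub>R f x)"
  by (simp add: bounded_clinear_def bounded_linear_scaleR_const
      bounded_linear_const_scaleR scaleC_scaleR_commute)

lemma bounded_clinear_diff:
  "bounded_clinear f \<Longrightarrow> bounded_clinear g \<Longrightarrow> bounded_clinear (\<lambda>x. f x - g x)"
  by (simp add: bounded_clinear_def bounded_linear_sub scaleC_diff)

lemma bounded_clinear_id: "bounded_clinear (\<lambda>x. x)"
  by (simp add: bounded_clinear_def bounded_linear_ident)

lemma bounded_clinear_zero: "bounded_clinear (\<lambda>x. 0)"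
  by (simp add: bounded_clinear_def scaleC_zero)

lemma bounded_clinear_sum:
  "(\<And>i. i \<in> I \<Longrightarrow> bounded_clinear (f i)) \<Longrightarrow> bounded_clinear (\<lambda>x. \<Sum>i\<in>I. f i x)"
  by (induction I rule: infinite_finite_induct)
    (simp_all add: bounded_clinear_zero bounded_clinear_add)

lemma bounded_clinear_funpow:
  fixes f :: "'a::complex_normed_vector \<Rightarrow> 'a"
  shows "bounded_clinear f \<Longrightarrow> bounded_clinear (f ^^ n)"
proof (induction n)
  case 0
  have "f ^^ 0 = (\<lambda>x. x)" by auto
  then show ?case by (simp only: bounded_clinear_id)
next
  case (Suc n)
  then show ?case using bounded_clinear_compose[of f "f ^^ n"] by (simp add: comp_def)
qed

lemma csubspace_iff:
  "csubspace S \<longleftrightarrow> 0 \<in> S \<and> (\<forall>x\<in>S. \<forall>y\<in>S. x + y \<in> S) \<and> (\<forall>c. \<forall>x\<in>S. c *\<^sub>C x \<in> S)"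
  by (auto simp: complex_vector.subspace_def)

lemma csubspace_scaleR: "csubspace S \<Longrightarrow> x \<in> S \<Longrightarrow> r *\<^sub>R x \<in> S"
  by (simp add: csubspace_iff scaleR_scaleC)

lemma csubspace_range:
  assumes "bounded_clinear f"
  shows "csubspace (range f)"
  unfolding csubspace_iff
proof (intro conjI ballI allI)
  interpret bounded_linear f by (rule bounded_clinear_bounded_linear[OF assms])
  show "0 \<in> range f" using zero by (metis rangeI)
  fix x y assume "x \<in> range f" "y \<in> range f"
  then show "x + y \<in> range f" by (auto simp flip: add)
next
  fix c :: complex and x assume "x \<in> range f"
  then show "c *\<^sub>C x \<in> range f" by (auto simp flip: bounded_clinear_scaleC[OF assms])
qed

lemma csubspace_closure:
  fixes S :: "'a::complex_normed_vector set"
  assumes "csubspace S"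
  shows "csubspace (closure S)"
  unfolding csubspace_iff
proof (intro conjI ballI allI)
  show "0 \<in> closure S"
    using assms closure_subset[of S] by (auto simp: csubspace_iff)
next
  fix x y assume "x \<in> closure S" "y \<in> closure S"
  then obtain f g where "\<And>n. f n \<in> S" "f \<longlonglongrightarrow> x" "\<And>n. g n \<in> S" "g \<longlonglongrightarrow> y"
    unfolding closure_sequential by blast
  then show "x + y \<in> closure S"
    using assms unfolding closure_sequential csubspace_iff
    by (intro exI[of _ "\<lambda>n. f n + g n"]) (auto intro: tendsto_add)
next
  fix c :: complex and x assume "x \<in> closure S"
  then obtain f where f: "\<And>n. f n \<in> S" "f \<longlonglongrightarrow> x"
    unfolding closure_sequential by blast
  have "bounded_linear (\<lambda>x :: 'a. c *\<^sub>C x)"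
    by (rule bounded_linear_intro[where K = "cmod c"])
      (simp_all add: scaleC_add_right scaleC_scaleR_commute norm_scaleC)
  from bounded_linear.tendsto[OF this f(2)] f(1) show "c *\<^sub>C x \<in> closure S"
    using assms unfolding closure_sequential csubspace_iff
    by (intro exI[of _ "\<lambda>n. c *\<^sub>C f n"]) auto
qed

text \<open>The distance to \<open>Z\<close> vanishes on \<open>Z\<close> and is at most the norm,
  so as a majorant it yields annihilation of \<open>Z\<close> and a norm bound at once.\<close>

lemma sublinear_infdist_csubspace:
  fixes Z :: "'a::complex_normed_vector set"
  assumes Z: "csubspace Z"
  shows "sublinear (\<lambda>x. infdist x Z)"
proof (rule sublinearI)
  have ne: "Z \<noteq> {}" using Z by (auto simp: csubspace_iff)
  note greatest = cINF_greatest[OF ne]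
  fix x y :: 'a
  have "infdist (x + y) Z - dist x a \<le> dist y b" if "a \<in> Z" "b \<in> Z" for a b
  proof -
    have "infdist (x + y) Z \<le> dist (x + y) (a + b)"
      using Z that by (intro infdist_le) (simp add: csubspace_iff)
    then show ?thesis using dist_triangle_add[of x y a b] by simp
  qed
  then have "infdist (x + y) Z - infdist y Z \<le> dist x a" if "a \<in> Z" for a
    using greatest[of "infdist (x + y) Z - dist x a" "dist y"] that
    by (fastforce simp: infdist_notempty[OF ne, of y])
  then have "infdist (x + y) Z - infdist y Z \<le> infdist x Z"
    using greatest[of "infdist (x + y) Z - infdist y Z" "dist x"] ne
    by (simp add: infdist_notempty[of Z x])
  then show "infdist (x + y) Z \<le> infdist x Z + infdist y Z" by simp
next
  show "infdist 0 Z = 0" using Z by (simp add: csubspace_iff)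
next
  fix c :: real and x :: 'a
  assume c: "0 < c"
  have ne: "Z \<noteq> {}" using Z by (auto simp: csubspace_iff)
  have "infdist (c *\<^sub>R x) Z / c \<le> dist x a" if "a \<in> Z" for a
  proof -
    have "infdist (c *\<^sub>R x) Z \<le> dist (c *\<^sub>R x) (c *\<^sub>R a)"
      using csubspace_scaleR[OF Z that] by (rule infdist_le)
    also have "\<dots> = c * dist x a" using c by (simp add: dist_norm flip: scaleR_diff_right)
    finally show ?thesis using c by (simp add: field_simps)
  qed
  then have "infdist (c *\<^sub>R x) Z / c \<le> infdist x Z"
    using ne by (simp add: infdist_notempty[of Z x] cINF_greatest)
  then show "infdist (c *\<^sub>R x) Z \<le> c * infdist x Z" using c by (simp add: field_simps)
qed

text \<open>A real functional \<open>f\<close> below the distance, attaining it at \<open>y\<close>,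
  is complexified to the functional with real part \<open>f x\<close> and imaginary part
  \<open>- f (\<i> *\<^sub>C x)\<close>.\<close>

theorem hahn_banach_csubspace:
  fixes Z :: "'a::complex_normed_vector set"
  assumes Z: "csubspace Z"
  obtains \<phi> where "\<phi> \<in> cdual" "\<And>x. norm (\<phi> x) \<le> norm x" "\<And>z. z \<in> Z \<Longrightarrow> \<phi> z = 0"
    "Re (\<phi> y) = infdist y Z"
proof -
  obtain f where f: "linear f" "\<And>x. f x \<le> infdist x Z" "f y = infdist y Z"
    using hahn_banach_sublinear[OF sublinear_infdist_csubspace[OF Z]] by metis
  define \<phi> where "\<phi> = (\<lambda>x. Complex (f x) (- f (\<i> *\<^sub>C x)))"
  have add: "\<phi> (x + z) = \<phi> x + \<phi> z" for x z
    by (simp add: \<phi>_def scaleC_add_right linear_add[OF f(1)] complex_eq_iff)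
  have scale: "\<phi> (c *\<^sub>C x) = c * \<phi> x" for c x
  proof -
    have c: "c *\<^sub>C x = Re c *\<^sub>R x + Im c *\<^sub>R (\<i> *\<^sub>C x)"
      by (simp add: scaleR_scaleC scaleC_scaleC flip: scaleC_add_left)
        (metis complex_eq mult.commute)
    have "\<i> *\<^sub>C (c *\<^sub>C x) = Re c *\<^sub>R (\<i> *\<^sub>C x) + (- Im c) *\<^sub>R x"
      unfolding c by (simp add: scaleR_scaleC scaleC_scaleC scaleC_add_right algebra_simps)
    then show ?thesis
      by (simp only: \<phi>_def c)
        (simp add: linear_add[OF f(1)] linear_diff[OF f(1)] linear_scale[OF f(1)]
          complex_eq_iff)
  qed
  \<comment> \<open>Rotating \<open>x\<close> by the conjugate phase \<open>c\<close> turns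
    \<open>\<phi> x\<close> into its modulus, which is then a value of \<open>f\<close>. If
    \<open>\<phi> x = 0\<close>, then \<open>c = 0\<close>.\<close>
  have norm: "norm (\<phi> x) \<le> infdist (c *\<^sub>C x) Z" if "c = cnj (sgn (\<phi> x))" for x c
  proof -
    have "cmod (\<phi> x) = Re (c * \<phi> x)"
      unfolding that sgn_eq
      by (simp add: complex_mult_cnj mult.commute[of "cnj _"])
        (simp add: cmod_def power2_eq_square complex_norm_square real_div_sqrt)
    also have "\<dots> = f (c *\<^sub>C x)" using arg_cong[OF scale[of c x], of Re] by (simp add: \<phi>_def)
    finally show ?thesis using f(2) by simp
  qed
  have norm_le: "norm (\<phi> x) \<le> norm x" for x
  proof -
    define c where "c = cnj (sgn (\<phi> x))"
    have "norm (\<phi> x) \<le> infdist (c *\<^sub>C x) Z" using norm c_def by blast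
    also have "\<dots> \<le> dist (c *\<^sub>C x) 0"
      using Z by (intro infdist_le) (simp add: csubspace_iff)
    also have "\<dots> \<le> 1 * norm x"
      unfolding dist_norm diff_0_right norm_scaleC
      by (intro mult_right_mono) (simp_all add: c_def norm_sgn)
    finally show ?thesis by simp
  qed
  have "\<phi> z = 0" if "z \<in> Z" for z
  proof -
    have "cnj (sgn (\<phi> z)) *\<^sub>C z \<in> Z" using Z that by (simp add: csubspace_iff)
    with norm[OF refl, of z] show ?thesis by simp
  qed
  moreover have "\<phi> \<in> cdual"
  proof -
    have "bounded_linear \<phi>"
      using add scale[of "of_real _"] norm_le
      by (intro bounded_linear_intro[where K = 1])
        (simp_all add: scaleR_scaleC scaleC_complex_def)
    then show ?thesis by (simp add: cdual_def bounded_clinear_def scale scaleC_complex_def)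
  qed
  moreover have "Re (\<phi> y) = infdist y Z" using f(3) by (simp add: \<phi>_def)
  ultimately show ?thesis using that norm_le by blast
qed

lemma norming_functional:
  fixes x :: "'a::complex_normed_vector"
  obtains \<phi> where "\<phi> \<in> cdual" "\<And>x. norm (\<phi> x) \<le> norm x" "Re (\<phi> x) = norm x"
proof -
  have "csubspace {0 :: 'a}" by (simp add: csubspace_iff scaleC_zero)
  from hahn_banach_csubspace[OF this, of x] that show ?thesis by (auto simp: dist_norm)
qed

text \<open>Banach-Alaoglu by way of Tychonoff: the evaluations at \<open>x n\<close> lie in a
  compact product of discs, a cluster point of them is an element of the bidual, and reflexivity
  represents it by \<open>y\<close>. Since \<open>y\<close> is tested only on functionals along
  which the sequence converges, a cluster point can stand in for the limit of a subsequence.\<close>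

lemma reflexive_weak_cluster_point:
  fixes x :: "nat \<Rightarrow> 'a::complex_normed_vector"
  assumes refl: "reflexive_space TYPE('a)" and bound: "\<And>n. norm (x n) \<le> M"
  obtains y where "\<And>\<phi> l. \<phi> \<in> cdual \<Longrightarrow> (\<lambda>n. \<phi> (x n)) \<longlonglongrightarrow> l \<Longrightarrow> \<phi> y = l"
proof -
  \<comment> \<open>The product is indexed by all functions, so coordinates outside
    \<open>cdual\<close> are pinned to 0.\<close>
  define K where "K = (\<Pi>\<^sub>E \<phi>\<in>UNIV. if \<phi> \<in> cdual then cball (0::complex) (M * onorm (\<phi> :: 'a \<Rightarrow> complex)) else {0})"
  define p where "p = (\<lambda>n (\<phi> :: 'a \<Rightarrow> complex). if \<phi> \<in> cdual then \<phi> (x n) else 0)"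
  have bl: "bounded_linear \<phi>" if "\<phi> \<in> cdual" for \<phi> :: "'a \<Rightarrow> complex"
    using that by (simp add: cdual_def bounded_clinear_def)
  have "compact K"
  proof -
    have "compactin (product_topology (\<lambda>_. euclidean) UNIV) K"
      unfolding K_def compactin_PiE by auto
    then show ?thesis by (simp add: euclidean_product_topology)
  qed
  moreover have pK: "p n \<in> K" for n
  proof -
    have "cmod (\<phi> (x n)) \<le> M * onorm \<phi>" if "\<phi> \<in> cdual" for \<phi>
    proof -
      have "cmod (\<phi> (x n)) \<le> onorm \<phi> * norm (x n)" by (rule onorm[OF bl[OF that]])
      also have "\<dots> \<le> onorm \<phi> * M"
        by (intro mult_left_mono bound onorm_pos_le bl[OF that])
      finally show ?thesis by (simp add: mult.commute)
    qed
    then show ?thesis by (auto simp: K_def p_def)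
  qed
  ultimately obtain F where F: "F \<in> K" "inf (nhds F) (filtermap p sequentially) \<noteq> bot"
    unfolding compact_filter
    by (metis (no_types, lifting) always_eventually eventually_filtermap
        filtermap_bot_iff sequentially_bot)
  \<comment> \<open>\<open>G\<close> refines both the neighbourhoods of \<open>F\<close> and the
    image of the tail filter under \<open>p\<close>. Limits along \<open>G\<close> therefore agree
    with \<open>F\<close> on coordinates and with every existing sequential limit.\<close>
  define G where "G = inf (nhds F) (filtermap p sequentially)"
  have coord: "((\<lambda>f. f \<phi>) \<longlongrightarrow> F \<phi>) G" for \<phi>
  proof (rule tendsto_mono)
    show "G \<le> nhds F" by (simp add: G_def)
    show "((\<lambda>f. f \<phi>) \<longlongrightarrow> F \<phi>) (nhds F)"
    proof (rule topological_tendstoI)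
      fix S :: "complex set" assume "open S" "F \<phi> \<in> S"
      moreover have "open ((\<lambda>f :: ('a \<Rightarrow> complex) \<Rightarrow> complex. f \<phi>) -` S)"
        by (intro open_vimage \<open>open S\<close> continuous_on_product_coordinates)
      ultimately show "\<forall>\<^sub>F f in nhds F. f \<phi> \<in> S"
        unfolding eventually_nhds by (intro exI[of _ "(\<lambda>f. f \<phi>) -` S"]) auto
    qed
  qed
  have lim_eq: "L = l" if "(g \<longlongrightarrow> L) G" "(\<lambda>n. g (p n)) \<longlonglongrightarrow> l"
    for g :: "_ \<Rightarrow> complex" and L l
  proof -
    have "(g \<longlongrightarrow> l) (filtermap p sequentially)" using that(2) by (simp add: filterlim_filtermap)
    then have "(g \<longlongrightarrow> l) G" by (rule tendsto_mono[rotated]) (simp add: G_def)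
    with that(1) F(2) show ?thesis unfolding G_def by (intro tendsto_unique)
  qed
  have "F \<in> cbidual"
    unfolding cbidual_def
  proof (intro CollectI conjI ballI allI exI)
    fix \<phi> \<psi> :: "'a \<Rightarrow> complex" assume d: "\<phi> \<in> cdual" "\<psi> \<in> cdual"
    then have "(\<lambda>x. \<phi> x + \<psi> x) \<in> cdual" by (simp add: cdual_def bounded_clinear_add)
    \<comment> \<open>The difference of the two sides vanishes at every \<open>p n\<close>, so its
      limit along \<open>G\<close> is 0.\<close>
    with d show "F (\<lambda>x. \<phi> x + \<psi> x) = F \<phi> + F \<psi>"
      using lim_eq[of "\<lambda>f. f (\<lambda>x. \<phi> x + \<psi> x) - (f \<phi> + f \<psi>)", of "F (\<lambda>x. \<phi> x + \<psi> x) - (F \<phi> + F \<psi>)" 0]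
      by (force simp: p_def intro!: tendsto_diff tendsto_add coord)
  next
    fix c and \<phi> :: "'a \<Rightarrow> complex" assume d: "\<phi> \<in> cdual"
    then have "(\<lambda>x. c * \<phi> x) \<in> cdual"
      by (simp add: cdual_def bounded_clinear_def scaleC_complex_def
          bounded_linear_const_mult)
    with d show "F (\<lambda>x. c * \<phi> x) = c * F \<phi>"
      using lim_eq[of "\<lambda>f. f (\<lambda>x. c * \<phi> x) - c * f \<phi>", of "F (\<lambda>x. c * \<phi> x) - c * F \<phi>" 0]
      by (force simp: p_def intro!: tendsto_diff tendsto_mult coord tendsto_const)
  next
    fix \<phi> :: "'a \<Rightarrow> complex" assume d: "\<phi> \<in> cdual"
    have "F \<phi> \<in> cball 0 (M * onorm \<phi>)"
      using PiE_mem[OF F(1)[unfolded K_def] UNIV_I, of \<phi>] d by simp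
    then show "cmod (F \<phi>) \<le> M * onorm \<phi>" by simp
  qed
  then obtain y where y: "\<And>\<phi>. \<phi> \<in> cdual \<Longrightarrow> F \<phi> = \<phi> y"
    using refl unfolding reflexive_space_def by blast
  have "\<phi> y = l" if "\<phi> \<in> cdual" "(\<lambda>n. \<phi> (x n)) \<longlonglongrightarrow> l" for \<phi> l
    using lim_eq[OF coord, of \<phi> l] that y by (simp add: p_def)
  then show ?thesis using that by blast
qed

subsection \<open>Averaged operators\<close>

text \<open>Mean absolute deviation is at most standard deviation: the binomial expectation of the
  square of \<open>\<bar>n * q - k\<bar> - A\<close> is nonnegative and equals the variance minus
  \<open>A\<^sup>2\<close>.\<close>

lemma sum_abs_deviation_Bernstein:
  fixes q :: real
  assumes q: "0 \<le> q" "q \<le> 1"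
  shows "(\<Sum>k\<le>n. Bernstein n k q * \<bar>n * q - k\<bar>) \<le> sqrt (n * q * (1 - q))"
proof -
  define s where "s = sqrt (n * q * (1 - q))"
  define A where "A = (\<Sum>k\<le>n. Bernstein n k q * \<bar>n * q - k\<bar>)"
  have s2: "s\<^sup>2 = n * q * (1 - q)" using q by (simp add: s_def)
  have A0: "0 \<le> A" unfolding A_def
    by (intro sum_nonneg mult_nonneg_nonneg Bernstein_nonneg q) simp
  have "0 \<le> (\<Sum>k\<le>n. Bernstein n k q * (\<bar>n * q - k\<bar> - A)\<^sup>2)"
    by (intro sum_nonneg mult_nonneg_nonneg Bernstein_nonneg q) simp
  \<comment> \<open>The squares are rearranged into factorial moments, whose Bernstein sums have
    closed forms.\<close>
  also have "\<dots> = (\<Sum>k\<le>n. real k * (real k - 1) * Bernstein n k q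
      + (1 - 2 * (n * q)) * (real k * Bernstein n k q)
      + ((n * q)\<^sup>2 + A\<^sup>2) * Bernstein n k q - 2 * A * (Bernstein n k q * \<bar>n * q - k\<bar>))"
    by (intro sum.cong refl) (simp add: power2_eq_square algebra_simps abs_mult_self_eq)
  also have "\<dots> = real n * (real n - 1) * q\<^sup>2 + (1 - 2 * (n * q)) * (n * q)
      + ((n * q)\<^sup>2 + A\<^sup>2) - 2 * A * A"
    unfolding A_def[symmetric]
    by (simp add: sum.distrib sum_subtractf A_def[symmetric] flip: sum_distrib_left)
  also have "\<dots> = s\<^sup>2 - A\<^sup>2" unfolding s2 by (simp add: power2_eq_square algebra_simps)
  finally have "A\<^sup>2 \<le> s\<^sup>2" by simp
  then show ?thesis unfolding A_def[symmetric] s_def[symmetric]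
    by (rule power2_le_imp_le) (use q in \<open>simp add: s_def\<close>)
qed

locale averaged_operator =
  fixes T :: "'a::cbanach \<Rightarrow> 'a" and \<rho> :: real
  assumes T: "bounded_clinear T"
    and \<rho>: "0 < \<rho>" "\<rho> < 1"
    and averaged: "norm (T x - \<rho> *\<^sub>R x) \<le> (1 - \<rho>) * norm x"
begin

definition R :: "'a \<Rightarrow> 'a" where "R x = x - T x"

definition Z :: "'a set" where "Z = closure (range R)"

lemma R_clinear: "bounded_clinear R"
  unfolding R_def[abs_def] by (intro bounded_clinear_diff bounded_clinear_id T)

lemmas T_power = bounded_clinear_funpow[OF T]

sublocale T: bounded_linear T by (rule bounded_clinear_bounded_linear[OF T])
sublocale R: bounded_linear R by (rule bounded_clinear_bounded_linear[OF R_clinear])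
sublocale Tn: bounded_linear "T ^^ n" for n by (rule bounded_clinear_bounded_linear[OF T_power])

section \<open>Contractivity and commutation of the powers\<close>

lemma norm_T: "norm (T x) \<le> norm x"
proof -
  have "norm (T x) \<le> norm (\<rho> *\<^sub>R x) + norm (T x - \<rho> *\<^sub>R x)"
    using norm_triangle_sub by blast
  also have "\<dots> \<le> \<rho> * norm x + (1 - \<rho>) * norm x"
    using averaged[of x] \<rho> by simp
  finally show ?thesis by (simp add: algebra_simps)
qed

lemma norm_T_power: "norm ((T ^^ n) x) \<le> norm x"
  by (induction n) (use norm_T order_trans in auto)

lemma norm_T_power_mono: "m \<le> n \<Longrightarrow> norm ((T ^^ n) x) \<le> norm ((T ^^ m) x)"
proof (induction n rule: dec_induct)
  case (step n)
  then show ?case using norm_T[of "(T ^^ n) x"] by simp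
qed simp

lemma norm_R: "norm (R x) \<le> 2 * norm x"
  using norm_triangle_ineq4[of x "T x"] norm_T[of x] by (simp add: R_def)

lemma T_power_T: "(T ^^ n) (T x) = T ((T ^^ n) x)"
  by (simp add: funpow_swap1)

lemma T_power_R: "(T ^^ n) (R x) = R ((T ^^ n) x)"
  by (simp add: R_def Tn.diff T_power_T)

text \<open>Each step moves the orbit by \<open>(T ^^ n) (R x)\<close>, of norm at most
  \<open>norm (R x)\<close>. An almost fixed vector thus stays almost fixed for many steps.\<close>

lemma norm_T_power_minus_id: "norm ((T ^^ n) x - x) \<le> n * norm (R x)"
proof (induction n)
  case (Suc n)
  have "norm ((T ^^ Suc n) x - x) \<le> norm ((T ^^ n) x - x) + norm ((T ^^ n) (R x))"
    using norm_triangle_ineq4[of "(T ^^ n) x - x" "(T ^^ n) (R x)"]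
    by (simp add: R_def Tn.diff T_power_T algebra_simps)
  with Suc norm_T_power[of n "R x"] show ?case by (simp add: algebra_simps)
qed simp

text \<open>Writing \<open>T = \<rho> I + (1 - \<rho>) S\<close> with a contraction \<open>S\<close>, the powers of \<open>T\<close> are binomial
  averages of the powers of \<open>S\<close>, and \<open>(I - T) T\<^sup>n\<close> is controlled by the mean absolute
  deviation of the binomial distribution.\<close>

definition S :: "'a \<Rightarrow> 'a" where "S x = (1 / (1 - \<rho>)) *\<^sub>R (T x - \<rho> *\<^sub>R x)"

lemma T_eq: "T x = \<rho> *\<^sub>R x + (1 - \<rho>) *\<^sub>R S x"
  using \<rho> by (simp add: S_def)

lemma linear_S: "linear S"
  by (rule linearI)
    (simp_all add: S_def T.add T.scaleR scaleR_add_right scaleR_diff_right algebra_simps)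

lemma norm_S_power: "norm ((S ^^ n) x) \<le> norm x"
proof (induction n)
  case (Suc n)
  have "norm (S y) \<le> norm y" for y
  proof -
    have "norm (S y) = norm (T y - \<rho> *\<^sub>R y) / (1 - \<rho>)" using \<rho> by (simp add: S_def)
    then show ?thesis using averaged[of y] \<rho> by (simp add: pos_divide_le_eq mult.commute)
  qed
  with Suc show ?case by (auto intro: order_trans)
qed simp

lemma T_power_eq: "(T ^^ n) x = (\<Sum>k\<le>n. Bernstein n k (1 - \<rho>) *\<^sub>R (S ^^ k) x)"
proof (induction n)
  case 0
  then show ?case by (simp add: Bernstein_def)
next
  case (Suc n)
  \<comment> \<open>Pascal's rule for the binomial weights; for \<open>n \<le> k\<close> the weight
    \<open>Bernstein n (Suc k)\<close> is zero.\<close>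
  have Bern: "Bernstein (Suc n) (Suc k) (1 - \<rho>) =
      \<rho> * Bernstein n (Suc k) (1 - \<rho>) + (1 - \<rho>) * Bernstein n k (1 - \<rho>)" for k
  proof (cases "k < n")
    case True
    then have "n - k = Suc (n - Suc k)" by simp
    then show ?thesis by (simp add: Bernstein_def algebra_simps)
  next
    case False
    then show ?thesis by (simp add: Bernstein_def binomial_eq_0)
  qed
  have "(T ^^ Suc n) x = \<rho> *\<^sub>R (\<Sum>k\<le>n. Bernstein n k (1 - \<rho>) *\<^sub>R (S ^^ k) x)
      + (1 - \<rho>) *\<^sub>R (\<Sum>k\<le>n. Bernstein n k (1 - \<rho>) *\<^sub>R (S ^^ Suc k) x)"
    using T_eq[of "(T ^^ n) x"]
    by (simp add: Suc linear_sum[OF linear_S] linear_scale[OF linear_S])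
  also have "(\<Sum>k\<le>n. Bernstein n k (1 - \<rho>) *\<^sub>R (S ^^ k) x) =
      (\<Sum>k\<le>Suc n. Bernstein n k (1 - \<rho>) *\<^sub>R (S ^^ k) x)"
    by (simp add: Bernstein_def)
  also have "\<dots> = \<rho> ^ n *\<^sub>R x + (\<Sum>k\<le>n. Bernstein n (Suc k) (1 - \<rho>) *\<^sub>R (S ^^ Suc k) x)"
    by (subst sum.atMost_Suc_shift) (simp add: Bernstein_def)
  also have "\<rho> *\<^sub>R \<dots> + (1 - \<rho>) *\<^sub>R (\<Sum>k\<le>n. Bernstein n k (1 - \<rho>) *\<^sub>R (S ^^ Suc k) x) =
      \<rho> ^ Suc n *\<^sub>R x + (\<Sum>k\<le>n. Bernstein (Suc n) (Suc k) (1 - \<rho>) *\<^sub>R (S ^^ Suc k) x)"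
    by (simp add: Bern scaleR_add_left scaleR_add_right sum.distrib scaleR_sum_right)
  also have "\<dots> = (\<Sum>k\<le>Suc n. Bernstein (Suc n) k (1 - \<rho>) *\<^sub>R (S ^^ k) x)"
    by (subst sum.atMost_Suc_shift) (simp add: Bernstein_def)
  finally show ?case .
qed

text \<open>By the absorption identity for binomial coefficients, weighting the sum for
  \<open>T ^^ Suc n\<close> with \<open>k\<close> produces a multiple of
  \<open>S ((T ^^ n) x)\<close>. Subtracting it leaves a sum weighted by deviations from the
  binomial mean.\<close>

lemma T_power_R_eq:
  "(\<rho> * Suc n) *\<^sub>R (T ^^ n) (R x) =
    (\<Sum>k\<le>Suc n. (Bernstein (Suc n) k (1 - \<rho>) * (Suc n * (1 - \<rho>) - k)) *\<^sub>R (S ^^ k) x)"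
proof -
  have Bern: "Bernstein (Suc n) (Suc k) (1 - \<rho>) * Suc k = Suc n * (1 - \<rho>) * Bernstein n k (1 - \<rho>)"
    for k
  proof -
    have "real (Suc n choose Suc k) * Suc k = Suc n * real (n choose k)"
      using Suc_times_binomial_eq[of n k] by (simp only: of_nat_mult[symmetric] mult.commute)
    then show ?thesis unfolding Bernstein_def by (simp del: binomial_Suc_Suc of_nat_Suc)
  qed
  have "(\<Sum>k\<le>Suc n. (Bernstein (Suc n) k (1 - \<rho>) * k) *\<^sub>R (S ^^ k) x) =
      (\<Sum>k\<le>n. (Suc n * (1 - \<rho>) * Bernstein n k (1 - \<rho>)) *\<^sub>R (S ^^ Suc k) x)"
    unfolding Bern[symmetric] by (subst sum.atMost_Suc_shift) simp
  also have "\<dots> = (Suc n * (1 - \<rho>)) *\<^sub>R S ((T ^^ n) x)"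
    by (simp add: T_power_eq linear_sum[OF linear_S] linear_scale[OF linear_S]
        scaleR_sum_right del: of_nat_Suc)
  finally have k: "(\<Sum>k\<le>Suc n. (Bernstein (Suc n) k (1 - \<rho>) * k) *\<^sub>R (S ^^ k) x) =
      (Suc n * (1 - \<rho>)) *\<^sub>R S ((T ^^ n) x)" .
  have "(\<Sum>k\<le>Suc n. (Bernstein (Suc n) k (1 - \<rho>) * (Suc n * (1 - \<rho>) - k)) *\<^sub>R (S ^^ k) x) =
      (Suc n * (1 - \<rho>)) *\<^sub>R (T ^^ Suc n) x - (Suc n * (1 - \<rho>)) *\<^sub>R S ((T ^^ n) x)"
    unfolding k[symmetric] T_power_eq[of "Suc n"]
    by (simp add: right_diff_distrib scaleR_diff_left sum_subtractf scaleR_sum_right mult.commute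
        del: of_nat_Suc sum.atMost_Suc)
  also have "\<dots> = (\<rho> * Suc n) *\<^sub>R ((1 - \<rho>) *\<^sub>R ((T ^^ n) x - S ((T ^^ n) x)))"
    by (simp only: funpow.simps comp_apply T_eq[of "(T ^^ n) x"])
      (simp add: algebra_simps del: of_nat_Suc)
  also have "(1 - \<rho>) *\<^sub>R ((T ^^ n) x - S ((T ^^ n) x)) = (T ^^ n) (R x)"
    unfolding T_power_R using T_eq[of "(T ^^ n) x"] by (simp add: R_def algebra_simps)
  finally show ?thesis by simp
qed

text \<open>The constant left when the standard deviation
  \<open>sqrt (Suc n * (1 - \<rho>) * \<rho>)\<close> is divided by \<open>\<rho> * Suc n\<close>;
  the quotient is \<open>C / sqrt (Suc n)\<close>.\<close>

definition C :: real where "C = sqrt ((1 - \<rho>) / \<rho>)"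

lemma C_pos: "0 < C" using \<rho> by (simp add: C_def)

lemma norm_T_power_R: "norm ((T ^^ n) (R x)) \<le> C / sqrt (Suc n) * norm x"
proof -
  have "\<rho> * Suc n * norm ((T ^^ n) (R x)) = norm ((\<rho> * Suc n) *\<^sub>R (T ^^ n) (R x))"
    using \<rho> by simp
  also have "\<dots> \<le> (\<Sum>k\<le>Suc n.
      norm ((Bernstein (Suc n) k (1 - \<rho>) * (Suc n * (1 - \<rho>) - k)) *\<^sub>R (S ^^ k) x))"
    unfolding T_power_R_eq by (rule norm_sum)
  also have "\<dots> \<le> (\<Sum>k\<le>Suc n. Bernstein (Suc n) k (1 - \<rho>) * \<bar>Suc n * (1 - \<rho>) - k\<bar> * norm x)"
    using \<rho> by (intro sum_mono)
      (simp add: abs_mult Bernstein_nonneg mult_left_mono norm_S_power del: of_nat_Suc)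
  also have "\<dots> \<le> sqrt (Suc n * (1 - \<rho>) * \<rho>) * norm x"
    unfolding sum_distrib_right[symmetric]
    using sum_abs_deviation_Bernstein[of "1 - \<rho>" "Suc n"] \<rho>
    by (intro mult_right_mono) (simp_all del: of_nat_Suc sum.atMost_Suc)
  also have "\<dots> = \<rho> * Suc n * (C / sqrt (Suc n) * norm x)"
  proof -
    define a b c where "a = sqrt \<rho>" and "b = sqrt (Suc n)" and "c = sqrt (1 - \<rho>)"
    have "a \<noteq> 0" "b \<noteq> 0" using \<rho> by (simp_all add: a_def b_def)
    have "\<rho> * Suc n * (C / sqrt (Suc n)) = (a * a) * (b * b) * (c / a / b)"
      using \<rho> by (simp add: a_def b_def c_def C_def real_sqrt_divide)
    also have "\<dots> = b * c * a" using \<open>a \<noteq> 0\<close> \<open>b \<noteq> 0\<close> by simp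
    also have "\<dots> = sqrt (Suc n * (1 - \<rho>) * \<rho>)"
      by (simp add: a_def b_def c_def real_sqrt_mult del: of_nat_Suc)
    finally show ?thesis by (simp only: mult.assoc[symmetric])
  qed
  finally show ?thesis
    by (rule mult_left_le_imp_le) (use \<rho> in simp)
qed

lemma C_sqrt_tendsto: "(\<lambda>n. C / sqrt (Suc n)) \<longlonglongrightarrow> 0"
  by (rule real_tendsto_divide_at_top[OF tendsto_const])
    (intro filterlim_compose[OF sqrt_at_top]
      filterlim_compose[OF filterlim_real_sequentially filterlim_Suc])

section \<open>The subspaces \<open>Fix T\<close> and \<open>Z\<close>, and strong decay on
  \<open>Z\<close>\<close>

lemma csubspace_range_R: "csubspace (range R)"
  by (rule csubspace_range[OF R_clinear])

lemma csubspace_Z: "csubspace Z"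
  unfolding Z_def by (rule csubspace_closure[OF csubspace_range_R])

lemma R_in_Z: "R x \<in> Z"
  unfolding Z_def by (rule subsetD[OF closure_subset rangeI])

lemma csubspace_Fix: "csubspace (Fix T)"
  by (simp add: csubspace_iff Fix_def T.zero T.add bounded_clinear_scaleC[OF T])

lemma T_power_Fix: "x \<in> Fix T \<Longrightarrow> (T ^^ n) x = x"
  by (induction n) (simp_all add: Fix_def)

lemma Fix_iff_R: "x \<in> Fix T \<longleftrightarrow> R x = 0"
  by (simp add: Fix_def R_def eq_commute[of x])

lemma T_power_in_Z: "x \<in> Z \<Longrightarrow> (T ^^ n) x \<in> Z"
proof -
  assume "x \<in> Z"
  \<comment> \<open>The increments of the orbit lie in \<open>range R\<close>, so the orbit stays in
    the coset of \<open>x\<close> modulo \<open>range R\<close>.\<close>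
  moreover have "x - (T ^^ n) x \<in> range R"
  proof (induction n)
    case 0
    then show ?case using csubspace_range_R by (simp add: csubspace_iff)
  next
    case (Suc n)
    have eq: "x - (T ^^ Suc n) x = (x - (T ^^ n) x) + R ((T ^^ n) x)" by (simp add: R_def)
    show ?case
      unfolding eq by (rule complex_vector.subspace_add[OF csubspace_range_R Suc rangeI])
  qed
  then have "x - (T ^^ n) x \<in> Z" unfolding Z_def by (rule subsetD[OF closure_subset])
  ultimately have "x - (x - (T ^^ n) x) \<in> Z" by (rule complex_vector.subspace_diff[OF csubspace_Z])
  then show ?thesis by simp
qed

text \<open>On \<open>range R\<close> the rate \<open>C / sqrt (Suc n)\<close> gives decay;
  contractivity of the powers carries it over to the closure.\<close>

lemma T_power_tendsto_0:
  assumes "z \<in> Z"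
  shows "(\<lambda>n. (T ^^ n) z) \<longlonglongrightarrow> 0"
proof (rule LIMSEQ_I)
  fix e :: real assume e: "0 < e"
  with assms obtain x where x: "dist (R x) z < e / 2"
    unfolding Z_def closure_approachable by (metis (no_types, lifting) half_gt_zero rangeE)
  have "(\<lambda>n. C / sqrt (Suc n) * norm x) \<longlonglongrightarrow> 0 * norm x"
    by (intro tendsto_mult C_sqrt_tendsto tendsto_const)
  then obtain N where N: "\<And>n. n \<ge> N \<Longrightarrow> C / sqrt (Suc n) * norm x < e / 2"
    using e C_pos by (force dest!: LIMSEQ_D[where r = "e / 2"])
  have "norm ((T ^^ n) z) < e" if "n \<ge> N" for n
  proof -
    have "norm ((T ^^ n) z) \<le> norm ((T ^^ n) (R x)) + norm ((T ^^ n) (z - R x))"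
      using norm_triangle_ineq[of "(T ^^ n) (R x)" "(T ^^ n) (z - R x)"] by (simp add: Tn.diff)
    also have "\<dots> \<le> C / sqrt (Suc n) * norm x + norm (z - R x)"
      by (intro add_mono norm_T_power_R norm_T_power)
    also have "\<dots> < e / 2 + e / 2"
      using N[OF that] x by (intro add_strict_mono) (simp_all add: dist_norm norm_minus_commute)
    finally show ?thesis by simp
  qed
  then show "\<exists>N. \<forall>n\<ge>N. norm ((T ^^ n) z - 0) < e" by auto
qed

text \<open>An orbit starting in both spaces is constant and tends to 0.\<close>

lemma Fix_Int_Z: "Fix T \<inter> Z = {0}"
proof -
  have "x = 0" if "x \<in> Fix T" "x \<in> Z" for x
    using T_power_tendsto_0[OF that(2)] T_power_Fix[OF that(1)] by (simp add: LIMSEQ_const_iff)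
  then show ?thesis using csubspace_Fix csubspace_Z by (auto simp: csubspace_iff)
qed

text \<open>The mean ergodic theorem; asymptotic regularity of the orbit makes averaging
  unnecessary.\<close>

lemma direct_sum_Fix_Z:
  assumes "reflexive_space TYPE('a)"
  shows "direct_sum_decomposition (Fix T) Z"
proof -
  have "\<exists>a\<in>Fix T. \<exists>b\<in>Z. x = a + b" for x
  proof -
    obtain y where y: "\<And>\<phi> l. \<phi> \<in> cdual \<Longrightarrow> (\<lambda>n. \<phi> ((T ^^ n) x)) \<longlonglongrightarrow> l \<Longrightarrow> \<phi> y = l"
      by (rule reflexive_weak_cluster_point[where x = "\<lambda>n. (T ^^ n) x" and M = "norm x",
            OF assms norm_T_power]) blast
    \<comment> \<open>The orbit of \<open>R x\<close> tends to 0, so every functional of the form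
      \<open>\<phi> \<circ> R\<close> vanishes at the cluster point \<open>y\<close>; taking
      \<open>\<phi>\<close> to norm \<open>R y\<close> gives the claim.\<close>
    have "R y = 0"
    proof -
      obtain \<phi> where \<phi>: "\<phi> \<in> cdual" "Re (\<phi> (R y)) = norm (R y)" by (rule norming_functional)
      interpret \<phi>: bounded_linear \<phi> using \<phi>(1) by (simp add: cdual_def bounded_clinear_def)
      have "(\<lambda>n. (T ^^ n) (R x)) \<longlonglongrightarrow> 0" by (rule T_power_tendsto_0[OF R_in_Z])
      then have "(\<lambda>n. \<phi> (R ((T ^^ n) x))) \<longlonglongrightarrow> \<phi> 0" unfolding T_power_R by (rule \<phi>.tendsto)
      moreover have "(\<lambda>v. \<phi> (R v)) \<in> cdual"
        using \<phi>(1) R_clinear by (simp add: cdual_def bounded_clinear_compose)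
      ultimately have "\<phi> (R y) = \<phi> 0" by (rule y[rotated])
      then have "\<phi> (R y) = 0" by (simp only: \<phi>.zero)
      then show ?thesis using \<phi>(2) by simp
    qed
    \<comment> \<open>A functional annihilating \<open>Z\<close> is constant along the orbit, hence
      takes the same value at \<open>x\<close> and \<open>y\<close>; one that attains the distance
      from \<open>x - y\<close> to \<open>Z\<close> shows that this distance is 0.\<close>
    moreover have "x - y \<in> Z"
    proof -
      obtain \<phi> where \<phi>: "\<phi> \<in> cdual" "\<And>z. z \<in> Z \<Longrightarrow> \<phi> z = 0"
        "Re (\<phi> (x - y)) = infdist (x - y) Z"
        by (rule hahn_banach_csubspace[OF csubspace_Z]) blast
      interpret \<phi>: bounded_linear \<phi> using \<phi>(1) by (simp add: cdual_def bounded_clinear_def)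
      have "\<phi> (T v) = \<phi> v" for v using \<phi>(2)[OF R_in_Z, of v] by (simp add: R_def \<phi>.diff)
      then have "\<phi> ((T ^^ n) x) = \<phi> x" for n by (induction n) simp_all
      then have "\<phi> y = \<phi> x" by (intro y[OF \<phi>(1)]) simp
      then have "infdist (x - y) Z = 0" using \<phi>(3) by (simp add: \<phi>.diff)
      then show ?thesis
        using in_closure_iff_infdist_zero[of Z "x - y"] csubspace_Z
        by (auto simp: Z_def csubspace_iff)
    qed
    ultimately show ?thesis by (metis Fix_iff_R add.commute diff_add_cancel)
  qed
  then show ?thesis
    by (simp add: direct_sum_decomposition_def csubspace_Fix csubspace_Z Fix_Int_Z)
qed

end

subsection \<open>Slowly converging orbits\<close>

lemma convergent_summable_diff:
  fixes X :: "nat \<Rightarrow> 'a::banach"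
  assumes "\<And>k. norm (X (Suc k) - X k) \<le> b k" "summable b"
  shows "convergent X"
proof -
  have "summable (\<lambda>k. X (Suc k) - X k)"
    by (rule summable_comparison_test'[OF assms(2), of 0]) (rule assms(1))
  then have "convergent (\<lambda>n. \<Sum>k<n. X (Suc k) - X k)" by (simp add: summable_iff_convergent)
  then have "convergent (\<lambda>n. X n - X 0)" by (simp add: sum_lessThan_telescope)
  then have "convergent (\<lambda>n. (X n - X 0) + X 0)" by (intro convergent_add convergent_const)
  then show ?thesis by simp
qed

context averaged_operator
begin

lemma R_partial_sum: "R (\<Sum>i<n. (T ^^ i) v) = v - (T ^^ n) v"
proof (induction n)
  case (Suc n)
  then show ?case by (simp add: R.add) (simp add: R_def)
qed (simp add: R.zero)

text \<open>An almost eigenvector \<open>u\<close> and a functional norming it are smoothed to \<open>u - T\<^sup>L u\<close> and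
  \<open>\<phi> \<circ> T\<^sup>N \<circ> (I - T\<^sup>L)\<close>. Both factor through \<open>R\<close>, and both are almost invariant under \<open>T\<close>; this
  makes pairings of different scales nearly orthogonal.\<close>

lemma almost_eigenpair:
  assumes approx: "\<And>d. 0 < d \<Longrightarrow> \<exists>u\<in>Z. norm u = 1 \<and> norm (R u) \<le> d"
    and e: "0 < e"
  obtains y \<psi> where "\<psi> \<in> cdual" "norm (R y) \<le> 2" "\<And>v. norm (\<psi> (R v)) \<le> 2 * norm v"
    "1 / 2 \<le> Re (\<psi> (R (R y)))" "norm (R (R y)) \<le> e" "\<And>v. norm (\<psi> (R (R v))) \<le> e * norm v"
proof -
  \<comment> \<open>\<open>N\<close> is fixed before \<open>u\<close>: composing with
    \<open>T ^^ N\<close> makes the functional almost invariant, and \<open>d\<close> is then so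
    small that \<open>u\<close> barely moves in \<open>N\<close> steps.\<close>
  obtain N where "\<bar>C / sqrt (Suc N)\<bar> < e / 2"
    using LIMSEQ_D[OF C_sqrt_tendsto, of "e / 2"] e by auto
  then have N: "C / sqrt (Suc N) \<le> e / 2" by linarith
  define d where "d = min (e / 2) (1 / (8 * real (Suc N)))"
  have "0 < d" using e by (simp add: d_def)
  then obtain u where u: "u \<in> Z" "norm u = 1" "norm (R u) \<le> d" using approx by blast
  have d: "2 * d \<le> e" "real N * d \<le> 1 / 8"
  proof -
    have "real N * d \<le> real (Suc N) * (1 / (8 * real (Suc N)))"
      using \<open>0 < d\<close> unfolding d_def by (intro mult_mono) auto
    then show "real N * d \<le> 1 / 8" by (simp del: of_nat_Suc)
  qed (simp add: d_def)
  obtain \<phi> where \<phi>: "\<phi> \<in> cdual" "\<And>v. norm (\<phi> v) \<le> norm v" "Re (\<phi> u) = norm u"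
    by (rule norming_functional[of u]) blast+
  interpret \<phi>: bounded_linear \<phi> by (rule bounded_linear_cdual[OF \<phi>(1)])
  obtain L where "norm ((T ^^ L) u) < 1 / 16"
    using LIMSEQ_D[OF T_power_tendsto_0[OF u(1)], of "1 / 16"] by auto
  then have L: "norm ((T ^^ n) u) \<le> 1 / 16" if "L \<le> n" for n
    using norm_T_power_mono[OF that, of u] by simp
  \<comment> \<open>\<open>G\<close> inverts \<open>R\<close> up to \<open>T ^^ L\<close>: both
    compositions of \<open>R\<close> and \<open>G\<close> equal the identity minus
    \<open>T ^^ L\<close>.\<close>
  define G where "G v = (\<Sum>i<L. (T ^^ i) v)" for v
  define \<psi> where "\<psi> v = \<phi> ((T ^^ N) (G v))" for v
  have RG: "R (G v) = v - (T ^^ L) v" for v unfolding G_def by (rule R_partial_sum)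
  have GR: "G (R v) = v - (T ^^ L) v" for v
    unfolding RG[symmetric] G_def by (simp add: R.sum T_power_R)
  have norm_diff: "norm (v - (T ^^ L) v) \<le> 2 * norm v" for v
    using norm_triangle_ineq4[of v "(T ^^ L) v"] norm_T_power[of L v] by simp
  show ?thesis
  proof
    have "bounded_clinear G"
      unfolding G_def[abs_def] by (intro bounded_clinear_sum T_power)
    then show "\<psi> \<in> cdual"
      using bounded_clinear_compose[OF _ bounded_clinear_compose[OF T_power[of N]], of \<phi> G] \<phi>(1)
      by (simp add: \<psi>_def[abs_def] cdual_def)
    show "norm (R (G u)) \<le> 2" using norm_diff[of u] u(2) by (simp add: RG)
    have \<psi>R: "\<psi> (R v) = \<phi> ((T ^^ N) (v - (T ^^ L) v))" for v by (simp add: \<psi>_def GR)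
    show "norm (\<psi> (R v)) \<le> 2 * norm v" for v
      unfolding \<psi>R using \<phi>(2) norm_T_power norm_diff by (meson order_trans)
    \<comment> \<open>The square of the identity minus \<open>T ^^ L\<close> is expanded. The main
      term has real part 1, and the errors are at most 1/8, 2/16 and 1/16.\<close>
    have "\<psi> (R (R (G u))) =
        \<phi> u + \<phi> ((T ^^ N) u - u) - 2 * \<phi> ((T ^^ (N + L)) u) + \<phi> ((T ^^ (N + (L + L))) u)"
      unfolding \<psi>R RG by (simp add: Tn.diff \<phi>.diff funpow_add)
    then have "Re (\<psi> (R (R (G u)))) = 1 + Re (\<phi> ((T ^^ N) u - u))
        - 2 * Re (\<phi> ((T ^^ (N + L)) u)) + Re (\<phi> ((T ^^ (N + (L + L))) u))"
      using \<phi>(3) u(2) by simp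
    moreover have "\<bar>Re (\<phi> ((T ^^ N) u - u))\<bar> \<le> 1 / 8"
    proof -
      have "norm ((T ^^ N) u - u) \<le> real N * d"
        using norm_T_power_minus_id[of N u] mult_left_mono[OF u(3), of "real N"] by linarith
      then show ?thesis using \<phi>(2)[of "(T ^^ N) u - u"] abs_Re_le_cmod[of "\<phi> ((T ^^ N) u - u)"] d
        by linarith
    qed
    moreover have "\<bar>Re (\<phi> ((T ^^ (N + l)) u))\<bar> \<le> 1 / 16" if "L \<le> l" for l
      using \<phi>(2)[of "(T ^^ (N + l)) u"] abs_Re_le_cmod[of "\<phi> ((T ^^ (N + l)) u)"]
        L[of "N + l"] that by linarith
    from this[of L] this[of "L + L"]
    have "\<bar>Re (\<phi> ((T ^^ (N + L)) u))\<bar> \<le> 1 / 16" "\<bar>Re (\<phi> ((T ^^ (N + (L + L))) u))\<bar> \<le> 1 / 16"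
      by simp_all
    ultimately show "1 / 2 \<le> Re (\<psi> (R (R (G u))))" by linarith
    have "R (R (G u)) = R u - (T ^^ L) (R u)" unfolding RG T_power_R by (rule R.diff)
    then show "norm (R (R (G u))) \<le> e" using norm_diff[of "R u"] u(3) d(1) by simp
    show "norm (\<psi> (R (R v))) \<le> e * norm v" for v
    proof -
      have "\<psi> (R (R v)) = \<phi> ((T ^^ N) (R (v - (T ^^ L) v)))"
        unfolding \<psi>R by (simp add: R.diff T_power_R)
      then have "norm (\<psi> (R (R v))) \<le> norm ((T ^^ N) (R (v - (T ^^ L) v)))" by (simp add: \<phi>(2))
      also have "\<dots> \<le> C / sqrt (Suc N) * norm (v - (T ^^ L) v)" by (rule norm_T_power_R)
      also have "\<dots> \<le> e / 2 * (2 * norm v)" using e by (intro mult_mono N norm_diff) simp_all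
      finally show ?thesis by simp
    qed
  qed
qed

text \<open>The inductive step of the construction: a scale of weight \<open>a\<close> is added to
  both vector and functional. The cross terms with the old pair cost at most \<open>2 * h\<close>,
  because the new pair is almost invariant. The new pair's own term is at least
  \<open>a\<^sup>2 / 4\<close> while \<open>n < N\<close>, and at least
  \<open>- 4 * a\<^sup>2\<close> at all times.\<close>

lemma extend_pairing:
  assumes approx: "\<And>d. 0 < d \<Longrightarrow> \<exists>u\<in>Z. norm u = 1 \<and> norm (R u) \<le> d"
    and \<psi>0: "\<psi>\<^sub>0 \<in> cdual" and a: "0 < a" "a \<le> 1" and h: "0 < h"
  obtains y \<psi> where "\<psi> \<in> cdual" "norm (R y) \<le> 2" "\<And>v. norm (\<psi> (R v)) \<le> 2 * norm v"
    "\<And>n. Re (\<psi>\<^sub>0 (R ((T ^^ n) (R y\<^sub>0)))) - 2 * h - 4 * a\<^sup>2 \<le>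
      Re (\<psi>\<^sub>0 (R ((T ^^ n) (R y\<^sub>0 + a *\<^sub>R R y))) + a * \<psi> (R ((T ^^ n) (R y\<^sub>0 + a *\<^sub>R R y))))"
    "\<And>n. n < N \<Longrightarrow> Re (\<psi>\<^sub>0 (R ((T ^^ n) (R y\<^sub>0)))) - 2 * h + a\<^sup>2 / 4 \<le>
      Re (\<psi>\<^sub>0 (R ((T ^^ n) (R y\<^sub>0 + a *\<^sub>R R y))) + a * \<psi> (R ((T ^^ n) (R y\<^sub>0 + a *\<^sub>R R y))))"
proof -
  interpret \<psi>0: bounded_linear \<psi>\<^sub>0 by (rule bounded_linear_cdual[OF \<psi>0])
  obtain K where K: "0 < K" "\<And>v. norm (\<psi>\<^sub>0 v) \<le> norm v * K" using \<psi>0.pos_bounded by blast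
  \<comment> \<open>The first two terms bound the cross terms by \<open>h\<close>; the third keeps
    the new pairing within 1/4 of its initial value for \<open>n < N\<close>.\<close>
  define e where "e = min (h / K) (min (h / (norm y\<^sub>0 + 1)) (1 / (8 * real (Suc N))))"
  have e: "0 < e" "e * K \<le> h" "e * norm y\<^sub>0 \<le> h" "real N * e \<le> 1 / 8"
  proof -
    have pos: "0 < norm y\<^sub>0 + 1" using norm_ge_zero[of y\<^sub>0] by linarith
    then show "0 < e" using h K(1) by (simp add: e_def)
    have "e * K \<le> h / K * K" using K(1) by (intro mult_right_mono) (simp_all add: e_def)
    then show "e * K \<le> h" using K(1) by simp
    have "e * norm y\<^sub>0 \<le> h / (norm y\<^sub>0 + 1) * (norm y\<^sub>0 + 1)"
      using h pos by (intro mult_mono) (simp_all add: e_def)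
    then show "e * norm y\<^sub>0 \<le> h" using pos by simp
    have "real N * e \<le> real (Suc N) * (1 / (8 * real (Suc N)))"
      using \<open>0 < e\<close> by (intro mult_mono) (simp_all add: e_def)
    then show "real N * e \<le> 1 / 8" by (simp del: of_nat_Suc)
  qed
  obtain y \<psi> where \<psi>: "\<psi> \<in> cdual" "norm (R y) \<le> 2" "\<And>v. norm (\<psi> (R v)) \<le> 2 * norm v"
    "1 / 2 \<le> Re (\<psi> (R (R y)))" "norm (R (R y)) \<le> e" "\<And>v. norm (\<psi> (R (R v))) \<le> e * norm v"
    by (rule almost_eigenpair[OF approx e(1)]) blast+
  interpret \<psi>: bounded_linear \<psi> by (rule bounded_linear_cdual[OF \<psi>(1)])
  define s where "s n = Re (\<psi> (R ((T ^^ n) (R y))))" for n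
  have cross1: "\<bar>Re (\<psi> (R ((T ^^ n) (R y\<^sub>0))))\<bar> \<le> h" for n
  proof -
    have "norm (\<psi> (R ((T ^^ n) (R y\<^sub>0)))) \<le> e * norm ((T ^^ n) y\<^sub>0)"
      unfolding T_power_R by (rule \<psi>(6))
    also have "\<dots> \<le> e * norm y\<^sub>0" using e(1) by (intro mult_left_mono norm_T_power) simp
    finally show ?thesis
      using abs_Re_le_cmod[of "\<psi> (R ((T ^^ n) (R y\<^sub>0)))"] e(3) by linarith
  qed
  have cross2: "\<bar>Re (\<psi>\<^sub>0 (R ((T ^^ n) (R y))))\<bar> \<le> h" for n
  proof -
    have "norm (\<psi>\<^sub>0 ((T ^^ n) (R (R y)))) \<le> norm ((T ^^ n) (R (R y))) * K" by (rule K(2))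
    also have "\<dots> \<le> e * K"
      using K(1) norm_T_power[of n "R (R y)"] \<psi>(5) by (intro mult_right_mono) linarith+
    finally show ?thesis
      using abs_Re_le_cmod[of "\<psi>\<^sub>0 (R ((T ^^ n) (R y)))"] e(2) by (simp add: T_power_R)
  qed
  have s_ge: "- 4 \<le> s n" for n
  proof -
    have "norm (\<psi> (R ((T ^^ n) (R y)))) \<le> 4"
      using \<psi>(3)[of "(T ^^ n) (R y)"] norm_T_power[of n "R y"] \<psi>(2) by linarith
    then show ?thesis
      using abs_Re_le_cmod[of "\<psi> (R ((T ^^ n) (R y)))"] unfolding s_def by linarith
  qed
  have s_start: "1 / 4 \<le> s n" if "n < N" for n
  proof -
    have "norm ((T ^^ n) (R y) - R y) \<le> real n * norm (R (R y))" by (rule norm_T_power_minus_id)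
    also have "\<dots> \<le> real N * e" using that \<psi>(5) e(1) by (intro mult_mono) simp_all
    finally have "norm (\<psi> (R ((T ^^ n) (R y) - R y))) \<le> 1 / 4"
      using \<psi>(3)[of "(T ^^ n) (R y) - R y"] e(4) by linarith
    then have "\<bar>s n - Re (\<psi> (R (R y)))\<bar> \<le> 1 / 4"
      using abs_Re_le_cmod[of "\<psi> (R ((T ^^ n) (R y) - R y))"]
      unfolding s_def by (simp add: R.diff \<psi>.diff)
    then show ?thesis using \<psi>(4) by linarith
  qed
  have ge: "Re (\<psi>\<^sub>0 (R ((T ^^ n) (R y\<^sub>0)))) - 2 * h + a\<^sup>2 * s n \<le>
      Re (\<psi>\<^sub>0 (R ((T ^^ n) (R y\<^sub>0 + a *\<^sub>R R y))) + a * \<psi> (R ((T ^^ n) (R y\<^sub>0 + a *\<^sub>R R y))))" for n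
  proof -
    have "Re (\<psi>\<^sub>0 (R ((T ^^ n) (R y\<^sub>0 + a *\<^sub>R R y))) + a * \<psi> (R ((T ^^ n) (R y\<^sub>0 + a *\<^sub>R R y)))) =
        Re (\<psi>\<^sub>0 (R ((T ^^ n) (R y\<^sub>0)))) + a * Re (\<psi>\<^sub>0 (R ((T ^^ n) (R y))))
        + a * Re (\<psi> (R ((T ^^ n) (R y\<^sub>0)))) + a\<^sup>2 * s n"
      by (simp add: Tn.add Tn.scaleR R.add R.scaleR \<psi>0.add \<psi>0.scaleR \<psi>.add \<psi>.scaleR
          s_def power2_eq_square algebra_simps)
    moreover have "- h \<le> a * z" if "\<bar>z\<bar> \<le> h" for z
    proof -
      have "\<bar>a * z\<bar> \<le> 1 * h" unfolding abs_mult using a that by (intro mult_mono) simp_all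
      then show ?thesis by linarith
    qed
    from this[OF cross1[of n]] this[OF cross2[of n]]
    have "- h \<le> a * Re (\<psi>\<^sub>0 (R ((T ^^ n) (R y))))" "- h \<le> a * Re (\<psi> (R ((T ^^ n) (R y\<^sub>0))))"
      by simp_all
    ultimately show ?thesis by linarith
  qed
  show ?thesis
  proof (rule that[OF \<psi>(1-3)], goal_cases)
    case (1 n)
    have "a\<^sup>2 * - 4 \<le> a\<^sup>2 * s n" by (intro mult_left_mono s_ge) simp
    then show ?case using ge[of n] by linarith
  next
    case (2 n)
    have "a\<^sup>2 * (1 / 4) \<le> a\<^sup>2 * s n" using 2 by (intro mult_left_mono s_start) simp_all
    then show ?case using ge[of n] by linarith
  qed
qed

text \<open>Time is cut into blocks \<open>N k \<le> n < N (Suc k)\<close>, on which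
  \<open>r n \<le> q ^ k\<close>. There the scales up to \<open>k\<close> contribute at least
  \<open>- 5 * q ^ k\<close>, while each later scale \<open>j\<close> adds at least
  \<open>q ^ j / 8\<close>; these gains sum to more than \<open>6 * q ^ k\<close>.\<close>

lemma weakly_slow_orbit_le_1:
  fixes r :: "nat \<Rightarrow> real"
  assumes approx: "\<And>d. 0 < d \<Longrightarrow> \<exists>u\<in>Z. norm u = 1 \<and> norm (R u) \<le> d"
    and r: "r \<longlonglongrightarrow> 0" "\<And>n. r n \<le> 1"
  obtains x \<phi> where "x \<in> Z" "\<phi> \<in> cdual" "\<And>n. r n \<le> Re (\<phi> ((T ^^ n) x))"
proof -
  \<comment> \<open>Powers of \<open>\<theta>\<close> weight both vector and functional, hence
    powers of \<open>q\<close> weight the pairing. The value is close enough to 1 that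
    \<open>q / (8 * (1 - q))\<close> exceeds 6.\<close>
  define \<theta> :: real where "\<theta> = 99 / 100"
  define q where "q = \<theta>\<^sup>2"
  have q: "q = 9801 / 10000" by (simp add: q_def \<theta>_def power2_eq_square)
  define val where "val = (\<lambda>(y, \<psi>, _ :: nat) n. Re (\<psi> (R ((T ^^ n) (R y)))))"
  \<comment> \<open>A state stores \<open>y\<close> and \<open>\<psi>\<close>, whereas the vector
    and functional built are \<open>R y\<close> and \<open>\<psi> \<circ> R\<close>. Starting with
    \<open>N = 0\<close> makes the blocks cover every \<open>n\<close>.\<close>
  define P where "P = (\<lambda>k (s :: 'a \<times> ('a \<Rightarrow> complex) \<times> nat). case s of (y, \<psi>, N) \<Rightarrow>
    \<psi> \<in> cdual \<and> (\<forall>n\<ge>N. r n \<le> q ^ k \<and> - 5 * q ^ k \<le> val s n) \<and> (k = 0 \<longrightarrow> N = 0))"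
  define Q where "Q = (\<lambda>k (s :: 'a \<times> ('a \<Rightarrow> complex) \<times> nat) s'. case (s, s') of
    ((y, \<psi>, N), (y', \<psi>', N')) \<Rightarrow> N < N' \<and> norm (R y' - R y) \<le> 2 * \<theta> ^ Suc k
      \<and> (\<forall>v. norm (\<psi>' (R v) - \<psi> (R v)) \<le> 2 * \<theta> ^ Suc k * norm v)
      \<and> (\<forall>n<N'. val s n + q ^ Suc k / 8 \<le> val s' n))"
  have "\<exists>f. \<forall>k. P k (f k) \<and> Q k (f k) (f (Suc k))"
  proof (rule dependent_nat_choice)
    have "(\<lambda>x. 0) \<in> cdual" by (simp add: cdual_def bounded_clinear_zero)
    then show "\<exists>s. P 0 s"
      using r(2) by (intro exI[of _ "(0, \<lambda>x. 0, 0)"]) (simp add: P_def val_def)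
  next
    fix s k assume P: "P k s"
    obtain y\<^sub>0 \<psi>\<^sub>0 N\<^sub>0 where s: "s = (y\<^sub>0, \<psi>\<^sub>0, N\<^sub>0)" by (cases s)
    with P have \<psi>0: "\<psi>\<^sub>0 \<in> cdual" by (simp add: P_def)
    interpret \<psi>0: bounded_linear \<psi>\<^sub>0 by (rule bounded_linear_cdual[OF \<psi>0])
    \<comment> \<open>With \<open>a\<^sup>2 = q ^ Suc k\<close> below, the net gain
      \<open>a\<^sup>2 / 4 - 2 * h\<close> is \<open>q ^ Suc k / 8\<close>.\<close>
    define h where "h = q ^ Suc k / 16"
    have h: "0 < h" by (simp add: h_def q)
    have "\<forall>\<^sub>F n in sequentially. r n < q ^ Suc k"
      using r(1) h by (intro order_tendstoD) (simp_all add: h_def)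
    \<comment> \<open>The old pairing decays, so beyond a large \<open>N\<close> it exceeds
      \<open>- h\<close>. The bound \<open>- 5 * q ^ Suc k\<close> therefore does not accumulate the
      losses of earlier scales.\<close>
    moreover have "(\<lambda>n. Re (\<psi>\<^sub>0 (R ((T ^^ n) (R y\<^sub>0))))) \<longlonglongrightarrow> Re (\<psi>\<^sub>0 (R 0))"
      by (intro tendsto_Re \<psi>0.tendsto R.tendsto T_power_tendsto_0 R_in_Z)
    then have "\<forall>\<^sub>F n in sequentially. - h < Re (\<psi>\<^sub>0 (R ((T ^^ n) (R y\<^sub>0))))"
      by (rule order_tendstoD) (use h in \<open>simp add: R.zero \<psi>0.zero\<close>)
    moreover have "\<forall>\<^sub>F n in sequentially. N\<^sub>0 < n" by (rule eventually_gt_at_top)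
    ultimately have "\<forall>\<^sub>F n in sequentially.
        r n < q ^ Suc k \<and> - h < Re (\<psi>\<^sub>0 (R ((T ^^ n) (R y\<^sub>0)))) \<and> N\<^sub>0 < n"
      by eventually_elim simp
    then obtain N where N: "\<And>n. N \<le> n \<Longrightarrow>
        r n < q ^ Suc k \<and> - h < Re (\<psi>\<^sub>0 (R ((T ^^ n) (R y\<^sub>0)))) \<and> N\<^sub>0 < n"
      unfolding eventually_sequentially by blast
    define a where "a = \<theta> ^ Suc k"
    have a: "0 < a" "a \<le> 1"
      unfolding a_def by (simp add: \<theta>_def) (rule power_le_one, simp_all add: \<theta>_def)
    have a2: "a\<^sup>2 = q ^ Suc k"
      by (simp add: a_def q_def power_mult_distrib flip: power_mult) (simp add: mult.commute)
    obtain y and \<psi> :: "'a \<Rightarrow> complex" where \<psi>: "\<psi> \<in> cdual" "norm (R y) \<le> 2" "\<And>v. norm (\<psi> (R v)) \<le> 2 * norm v"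
      "\<And>n. Re (\<psi>\<^sub>0 (R ((T ^^ n) (R y\<^sub>0)))) - 2 * h - 4 * a\<^sup>2 \<le>
        Re (\<psi>\<^sub>0 (R ((T ^^ n) (R y\<^sub>0 + a *\<^sub>R R y))) + a * \<psi> (R ((T ^^ n) (R y\<^sub>0 + a *\<^sub>R R y))))"
      "\<And>n. n < N \<Longrightarrow> Re (\<psi>\<^sub>0 (R ((T ^^ n) (R y\<^sub>0)))) - 2 * h + a\<^sup>2 / 4 \<le>
        Re (\<psi>\<^sub>0 (R ((T ^^ n) (R y\<^sub>0 + a *\<^sub>R R y))) + a * \<psi> (R ((T ^^ n) (R y\<^sub>0 + a *\<^sub>R R y))))"
      by (rule extend_pairing[OF approx \<psi>0 a(1,2) h, where y\<^sub>0 = y\<^sub>0 and N = N])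
        blast+
    define s' where "s' = (y\<^sub>0 + a *\<^sub>R y, \<lambda>v. \<psi>\<^sub>0 v + a * \<psi> v, N)"
    have val': "val s' n = Re (\<psi>\<^sub>0 (R ((T ^^ n) (R y\<^sub>0 + a *\<^sub>R R y)))
        + a * \<psi> (R ((T ^^ n) (R y\<^sub>0 + a *\<^sub>R R y))))" for n
      by (simp add: s'_def val_def R.add R.scaleR)
    have val: "val s n = Re (\<psi>\<^sub>0 (R ((T ^^ n) (R y\<^sub>0))))" for n by (simp add: s val_def)
    have "(\<lambda>v. \<psi>\<^sub>0 v + a *\<^sub>R \<psi> v) \<in> cdual"
      using \<psi>0 \<psi>(1) unfolding cdual_def mem_Collect_eq
      by (intro bounded_clinear_add bounded_clinear_scaleR)
    then have dual: "(\<lambda>v. \<psi>\<^sub>0 v + a * \<psi> v) \<in> cdual" by (simp add: scaleR_conv_of_real)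
    have "- 5 * q ^ Suc k \<le> val s' n" if "N \<le> n" for n
      using \<psi>(4)[of n] N[OF that] h unfolding val' a2 h_def by linarith
    then have "P (Suc k) s'"
      using dual N unfolding P_def s'_def by (auto intro: less_imp_le)
    moreover have "Q k s s'"
    proof -
      have "N\<^sub>0 < N" using N by blast
      moreover have "norm (a *\<^sub>R R y) \<le> 2 * a" using \<psi>(2) a(1) by simp
      moreover have "norm (a * \<psi> (R v)) \<le> 2 * a * norm v" for v
        using \<psi>(3)[of v] a(1) by (simp add: norm_mult)
      moreover have "val s n + q ^ Suc k / 8 \<le> val s' n" if "n < N" for n
        using \<psi>(5)[OF that] unfolding val val' a2 h_def by linarith
      ultimately show ?thesis
        by (simp add: Q_def s s'_def R.add R.scaleR del: power_Suc flip: a_def)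
    qed
    ultimately show "\<exists>s'. P (Suc k) s' \<and> Q k s s'" by blast
  qed
  then obtain f where f: "\<And>k. P k (f k)" "\<And>k. Q k (f k) (f (Suc k))" by blast
  define y where "y k = fst (f k)" for k
  define \<psi> where "\<psi> k = fst (snd (f k))" for k
  define N where "N k = snd (snd (f k))" for k
  define v where "v k n = Re (\<psi> k (R ((T ^^ n) (R (y k)))))" for k n
  have f_eq: "f k = (y k, \<psi> k, N k)" for k by (simp add: y_def \<psi>_def N_def)
  have val: "val (f k) = v k" for k by (simp add: fun_eq_iff val_def f_eq v_def)
  have \<psi>: "\<psi> k \<in> cdual" for k using f(1)[of k] by (simp add: P_def f_eq)
  have tail: "r n \<le> q ^ k" "- 5 * q ^ k \<le> v k n" if "N k \<le> n" for k n
    using f(1)[of k] that by (simp_all add: P_def f_eq val[unfolded f_eq])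
  have N0: "N 0 = 0" using f(1)[of 0] by (simp add: P_def f_eq)
  have N_less: "N k < N (Suc k)" for k using f(2)[of k] by (simp add: Q_def f_eq)
  have y_diff: "norm (R (y (Suc k)) - R (y k)) \<le> 2 * \<theta> ^ Suc k" for k
    using f(2)[of k] by (simp add: Q_def f_eq)
  have \<psi>_diff: "norm (\<psi> (Suc k) (R u) - \<psi> k (R u)) \<le> 2 * \<theta> ^ Suc k * norm u" for k u
    using f(2)[of k] by (simp add: Q_def f_eq)
  have v_step: "v k n + q ^ Suc k / 8 \<le> v (Suc k) n" if "n < N (Suc k)" for k n
    using f(2)[of k] that by (simp add: Q_def f_eq val[unfolded f_eq])
  have summ: "summable (\<lambda>k. 2 * \<theta> ^ Suc k)"
    using summable_mult[OF summable_geometric[of \<theta>], of "2 * \<theta>"]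
    by (simp add: \<theta>_def mult.assoc)
  obtain x where x: "(\<lambda>k. R (y k)) \<longlonglongrightarrow> x"
    using convergent_summable_diff[of "\<lambda>k. R (y k)", OF y_diff summ] by (auto simp: convergent_def)
  have "x \<in> Z" unfolding Z_def closure_sequential
    using x by (intro exI[of _ "\<lambda>k. R (y k)"]) simp
  have \<psi>R: "bounded_clinear (\<lambda>u. \<psi> k (R u))" for k
    using \<psi>[of k] R_clinear by (simp add: cdual_def bounded_clinear_compose)
  \<comment> \<open>The functionals \<open>\<psi> k \<circ> R\<close> converge in operator norm; the
    limit is taken among real bounded linear maps, and complex linearity is recovered
    pointwise.\<close>
  define \<Phi> where "\<Phi> k = Blinfun (\<lambda>u. \<psi> k (R u))" for k
  have \<Phi>: "blinfun_apply (\<Phi> k) u = \<psi> k (R u)" for k u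
    unfolding \<Phi>_def by (simp add: bounded_linear_Blinfun_apply[OF bounded_clinear_bounded_linear[OF \<psi>R]])
  have "norm (\<Phi> (Suc k) - \<Phi> k) \<le> 2 * \<theta> ^ Suc k" for k
    using \<psi>_diff[of k] by (intro norm_blinfun_bound) (simp_all add: \<Phi> blinfun.diff_left \<theta>_def)
  then obtain \<phi> where \<phi>: "\<Phi> \<longlonglongrightarrow> \<phi>"
    using convergent_summable_diff[OF _ summ, of \<Phi>] by (auto simp: convergent_def)
  have "blinfun_apply \<phi> \<in> cdual"
  proof -
    have "blinfun_apply \<phi> (c *\<^sub>C u) = c * blinfun_apply \<phi> u" for c u
    proof (rule LIMSEQ_unique)
      show "(\<lambda>k. \<Phi> k (c *\<^sub>C u)) \<longlonglongrightarrow> \<phi> (c *\<^sub>C u)"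
        by (intro tendsto_intros \<phi>)
      have "\<Phi> k (c *\<^sub>C u) = c * \<Phi> k u" for k
        using bounded_clinear_scaleC[OF \<psi>R[of k], of c u] by (simp add: \<Phi> scaleC_complex_def)
      then show "(\<lambda>k. \<Phi> k (c *\<^sub>C u)) \<longlonglongrightarrow> c * \<phi> u"
        by (simp only:) (intro tendsto_intros \<phi>)
    qed
    then show ?thesis
      by (simp add: cdual_def bounded_clinear_def scaleC_complex_def blinfun.bounded_linear_right)
  qed
  moreover have "r n \<le> Re (\<phi> ((T ^^ n) x))" for n
  proof -
    have "(\<lambda>k. v k n) \<longlonglongrightarrow> Re (\<phi> ((T ^^ n) x))"
      unfolding v_def \<Phi>[symmetric] by (intro tendsto_Re blinfun.tendsto \<phi> Tn.tendsto x)
    obtain k where k: "N k \<le> n" "n < N (Suc k)"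
    proof -
      have "k \<le> N k" for k by (induction k) (use N_less Suc_leI le_less_trans in blast)+
      then have ex: "n < N (Suc n)" using Suc_le_lessD by blast
      \<comment> \<open>The least such index is the block containing \<open>n\<close>;
        \<open>N 0 = 0\<close> settles the case without a predecessor.\<close>
      define k where "k = (LEAST k. n < N (Suc k))"
      have "n < N (Suc k)" unfolding k_def using ex by (rule LeastI)
      moreover have "N k \<le> n"
      proof (cases k)
        case 0
        then show ?thesis by (simp add: N0)
      next
        case (Suc j)
        then have "\<not> n < N (Suc j)" using not_less_Least[of j "\<lambda>k. n < N (Suc k)"] k_def by simp
        then show ?thesis using Suc by simp
      qed
      ultimately show ?thesis using that by blast
    qed
    have N_mono: "N (Suc k) \<le> N (Suc j)" if "k \<le> j" for j
      using that by (induction j rule: dec_induct) (use N_less less_imp_le order_trans in blast)+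
    \<comment> \<open>The gains \<open>q ^ Suc i / 8\<close> for \<open>k \<le> i < j\<close> form a
      geometric sum; afterwards \<open>j\<close> tends to infinity.\<close>
    have "- 5 * q ^ k + (q ^ Suc k - q ^ Suc j) / (8 * (1 - q)) \<le> v j n" if "k \<le> j" for j
      using that
    proof (induction j rule: dec_induct)
      case base
      then show ?case using tail(2)[OF k(1)] by simp
    next
      case (step j)
      have "v j n + q ^ Suc j / 8 \<le> v (Suc j) n"
        using v_step[of n j] k(2) N_mono[of j] step(1) by simp
      moreover have "(q ^ Suc k - q ^ Suc (Suc j)) / (8 * (1 - q)) =
          (q ^ Suc k - q ^ Suc j) / (8 * (1 - q)) + q ^ Suc j / 8"
        by (simp add: q field_simps)
      ultimately show ?case using step.IH by linarith
    qed
    moreover have "(\<lambda>j. - 5 * q ^ k + (q ^ Suc k - q ^ Suc j) / (8 * (1 - q))) \<longlonglongrightarrow>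
        - 5 * q ^ k + (q ^ Suc k - 0) / (8 * (1 - q))"
    proof -
      have "(\<lambda>j. q ^ Suc j) \<longlonglongrightarrow> 0"
        by (rule LIMSEQ_Suc, rule LIMSEQ_power_zero) (simp add: q)
      moreover have "8 * (1 - q) \<noteq> 0" by (simp add: q)
      ultimately show ?thesis by (intro tendsto_intros)
    qed
    ultimately have "- 5 * q ^ k + (q ^ Suc k - 0) / (8 * (1 - q)) \<le> Re (\<phi> ((T ^^ n) x))"
      using \<open>(\<lambda>k. v k n) \<longlonglongrightarrow> Re (\<phi> ((T ^^ n) x))\<close> by (intro LIMSEQ_le) blast+
    moreover have "q ^ k \<le> - 5 * q ^ k + (q ^ Suc k - 0) / (8 * (1 - q))" by (simp add: q)
    ultimately show ?thesis using tail(1)[OF k(1)] by linarith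
  qed
  ultimately show ?thesis using that \<open>x \<in> Z\<close> by blast
qed

lemma weakly_slow_orbit:
  fixes r :: "nat \<Rightarrow> real"
  assumes approx: "\<And>d. 0 < d \<Longrightarrow> \<exists>u\<in>Z. norm u = 1 \<and> norm (R u) \<le> d"
    and r: "r \<longlonglongrightarrow> 0"
  obtains x \<phi> where "x \<in> Z" "\<phi> \<in> cdual" "\<And>n. r n \<le> Re (\<phi> ((T ^^ n) x))"
proof -
  have "Bseq r" using r by (intro convergent_imp_Bseq convergentI)
  then obtain B where B: "0 < B" "\<And>n. norm (r n) \<le> B" by (auto elim: BseqE)
  have "(\<lambda>n. r n / B) \<longlonglongrightarrow> 0" using tendsto_divide[OF r tendsto_const, of B] B(1) by simp
  moreover have "r n / B \<le> 1" for n using B(2)[of n] B(1) by simp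
  ultimately obtain x \<phi> where x: "x \<in> Z" "\<phi> \<in> cdual" "\<And>n. r n / B \<le> Re (\<phi> ((T ^^ n) x))"
    using weakly_slow_orbit_le_1[OF approx, of "\<lambda>n. r n / B"] by blast
  have "r n \<le> Re (\<phi> ((T ^^ n) (B *\<^sub>R x)))" for n
  proof -
    have "Re (\<phi> ((T ^^ n) (B *\<^sub>R x))) = B * Re (\<phi> ((T ^^ n) x))"
      using bounded_linear_cdual[OF x(2)] by (simp add: Tn.scaleR bounded_linear.linear linear_scale)
    then show ?thesis using x(3)[of n] B(1) by (simp add: pos_divide_le_eq mult.commute)
  qed
  then show ?thesis using that csubspace_scaleR[OF csubspace_Z x(1)] x(2) by blast
qed

subsection \<open>Rates of convergence\<close>

text \<open>The dichotomy behind the two rates: the first case produces slow orbits, the second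
  exponential decay and closed range.\<close>

lemma approximate_eigenvectors_or_bounded_below:
  obtains (approx) "\<And>d. 0 < d \<Longrightarrow> \<exists>u\<in>Z. norm u = 1 \<and> norm (R u) \<le> d"
  | (bounded_below) d where "0 < d" "\<And>z. z \<in> Z \<Longrightarrow> d * norm z \<le> norm (R z)"
proof (cases "\<forall>d>0. \<exists>u\<in>Z. norm u = 1 \<and> norm (R u) \<le> d")
  case True
  then show ?thesis using approx by blast
next
  case False
  then obtain d where d: "0 < d" "\<And>u. u \<in> Z \<Longrightarrow> norm u = 1 \<Longrightarrow> d < norm (R u)" by force
  have "d * norm z \<le> norm (R z)" if "z \<in> Z" for z
  proof (cases "z = 0")
    case False
    have "inverse (norm z) *\<^sub>R z \<in> Z" using csubspace_scaleR[OF csubspace_Z that] .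
    then have "d < norm (R (inverse (norm z) *\<^sub>R z))" using False by (intro d(2)) simp_all
    then show ?thesis using False by (simp add: R.scaleR field_simps)
  qed simp
  then show ?thesis using bounded_below d(1) by blast
qed

text \<open>Approximate eigenvectors would give a starting point in \<open>Z\<close> whose orbit
  pairs to at least \<open>(n+1)^(-1/4)\<close>. If the range is closed, this point is some
  \<open>R y\<close>, whose orbit is of order \<open>(n+1)^(-1/2)\<close>, a contradiction.\<close>

lemma bounded_below_if_closed_range:
  assumes closed: "closed (range R)"
  obtains d where "0 < d" "\<And>z. z \<in> Z \<Longrightarrow> d * norm z \<le> norm (R z)"
proof (cases rule: approximate_eigenvectors_or_bounded_below)
  case approx
  define r where "r n = 1 / sqrt (sqrt (Suc n))" for n
  have lim: "LIM n sequentially. sqrt (sqrt (real (Suc n))) :> at_top"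
    by (intro filterlim_compose[OF sqrt_at_top]
        filterlim_compose[OF filterlim_real_sequentially filterlim_Suc])
  have "r \<longlonglongrightarrow> 0"
    unfolding r_def[abs_def] by (rule real_tendsto_divide_at_top[OF tendsto_const lim])
  then obtain x \<phi> where x: "x \<in> Z" "\<phi> \<in> cdual" "\<And>n. r n \<le> Re (\<phi> ((T ^^ n) x))"
    by (rule weakly_slow_orbit[OF approx, rotated]) blast+
  interpret \<phi>: bounded_linear \<phi> by (rule bounded_linear_cdual[OF x(2)])
  obtain K where K: "0 < K" "\<And>v. norm (\<phi> v) \<le> norm v * K" using \<phi>.pos_bounded by blast
  have "x \<in> range R" using x(1) closed by (simp add: Z_def)
  then obtain y where y: "x = R y" by blast
  have "sqrt (sqrt (Suc n)) \<le> C * norm y * K" for n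
  proof -
    define s where "s = sqrt (sqrt (Suc n))"
    have s: "0 < s" "sqrt (Suc n) = s * s" by (simp_all add: s_def)
    have "1 / s \<le> Re (\<phi> ((T ^^ n) x))" using x(3)[of n] by (simp add: r_def s_def)
    also have "\<dots> \<le> norm ((T ^^ n) x) * K"
      using complex_Re_le_cmod K(2) order_trans by blast
    also have "\<dots> \<le> C / sqrt (Suc n) * norm y * K"
      unfolding y using K(1) by (intro mult_right_mono norm_T_power_R) simp
    finally have "1 / s \<le> C * norm y * K / (s * s)" unfolding s(2) by simp
    then have "s \<le> C * norm y * K" using s(1) by (simp add: field_simps)
    then show ?thesis by (simp only: s_def)
  qed
  moreover have "\<forall>\<^sub>F n in sequentially. C * norm y * K < sqrt (sqrt (Suc n))"
    using lim unfolding filterlim_at_top_dense by (rule spec)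
  then have "\<exists>n. C * norm y * K < sqrt (sqrt (Suc n))"
    by (rule eventually_happens'[OF sequentially_bot])
  ultimately show ?thesis by (meson not_le)
next
  case (bounded_below d)
  then show ?thesis using that by blast
qed

text \<open>The lower bound for \<open>R\<close> turns the decay of \<open>R ((T ^^ n) z)\<close>
  into decay of \<open>(T ^^ n) z\<close> uniform in \<open>z\<close>, so some power of
  \<open>T\<close> halves norms on \<open>Z\<close>.\<close>

lemma exponential_decay_on_Z:
  assumes closed: "closed (range R)"
  obtains r where "0 \<le> r" "r < 1" "\<And>n z. z \<in> Z \<Longrightarrow> norm ((T ^^ n) z) \<le> 2 * r ^ n * norm z"
proof -
  obtain d where d: "0 < d" "\<And>z. z \<in> Z \<Longrightarrow> d * norm z \<le> norm (R z)"
    by (rule bounded_below_if_closed_range[OF closed]) blast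
  have "\<forall>\<^sub>F n in sequentially. C / sqrt (Suc n) < d / 2"
    by (rule order_tendstoD(2)[OF C_sqrt_tendsto]) (use d(1) in simp)
  then have "\<forall>\<^sub>F n in sequentially. C / sqrt (Suc n) < d / 2 \<and> 0 < n"
    using eventually_gt_at_top[of "0 :: nat"] by eventually_elim simp
  then obtain m where m: "C / sqrt (Suc m) < d / 2" "0 < m"
    unfolding eventually_sequentially by blast
  have half: "norm ((T ^^ m) z) \<le> norm z / 2" if "z \<in> Z" for z
  proof -
    have "d * norm ((T ^^ m) z) \<le> norm (R ((T ^^ m) z))" by (rule d(2)[OF T_power_in_Z[OF that]])
    also have "\<dots> \<le> C / sqrt (Suc m) * norm z" using norm_T_power_R[of m z] by (simp add: T_power_R)
    also have "\<dots> \<le> d / 2 * norm z" using m(1) by (intro mult_right_mono) simp_all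
    finally show ?thesis using d(1) by simp
  qed
  have halves: "norm ((T ^^ (m * k)) z) \<le> (1 / 2) ^ k * norm z" if "z \<in> Z" for z k
  proof (induction k)
    case (Suc k)
    have "norm ((T ^^ (m * Suc k)) z) \<le> norm ((T ^^ (m * k)) z) / 2"
      using half[OF T_power_in_Z[OF that]] by (simp add: funpow_add)
    with Suc show ?case by simp
  qed simp
  \<comment> \<open>The \<open>m\<close>-th power of \<open>r\<close> is the halving factor; the
    constant 2 pays for the remainder \<open>n mod m\<close>.\<close>
  define r where "r = root m (1 / 2)"
  have r: "0 < r" "r < 1" "r ^ m = 1 / 2" using m(2) by (simp_all add: r_def)
  have "norm ((T ^^ n) z) \<le> 2 * r ^ n * norm z" if "z \<in> Z" for n z
  proof -
    have "norm ((T ^^ n) z) \<le> norm ((T ^^ (m * (n div m))) z)" by (intro norm_T_power_mono) simp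
    also have "\<dots> \<le> r ^ (m * (n div m)) * norm z" using halves[OF that] by (simp add: power_mult r(3))
    also have "\<dots> \<le> 2 * r ^ n * norm z"
    proof (intro mult_right_mono)
      have "r ^ m \<le> r ^ (n mod m)"
        using r m(2) by (intro power_decreasing) (simp_all add: less_imp_le)
      then have "(1 / 2) * r ^ (m * (n div m)) \<le> r ^ (n mod m) * r ^ (m * (n div m))"
        unfolding r(3) using r(1) by (intro mult_right_mono) simp_all
      also have "\<dots> = r ^ n" by (simp flip: power_add)
      finally show "r ^ (m * (n div m)) \<le> 2 * r ^ n" by simp
    qed simp
    finally show ?thesis .
  qed
  then show ?thesis using that[OF less_imp_le[OF r(1)] r(2)] by blast
qed

text \<open>Each of the \<open>k\<close> factors \<open>R\<close> is paired with \<open>m\<close> of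
  the factors \<open>T\<close>, and every such group contributes one factor
  \<open>C / sqrt (Suc m)\<close>.\<close>

lemma norm_T_power_R_power:
  "norm ((T ^^ (k * m)) ((R ^^ k) y)) \<le> (C / sqrt (Suc m)) ^ k * norm y"
proof (induction k arbitrary: y)
  case (Suc k)
  have "(T ^^ (Suc k * m)) ((R ^^ Suc k) y) = (T ^^ (k * m)) ((T ^^ m) ((R ^^ k) (R y)))"
    by (simp add: funpow_swap1 add.commute[of m] funpow_add)
  also have "(T ^^ m) ((R ^^ k) (R y)) = (R ^^ k) ((T ^^ m) (R y))"
    by (induction k) (simp_all add: T_power_R)
  finally have "norm ((T ^^ (Suc k * m)) ((R ^^ Suc k) y)) \<le>
      (C / sqrt (Suc m)) ^ k * norm ((T ^^ m) (R y))"
    using Suc by simp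
  also have "\<dots> \<le> (C / sqrt (Suc m)) ^ k * (C / sqrt (Suc m) * norm y)"
    using C_pos by (intro mult_left_mono norm_T_power_R zero_le_power) simp
  finally show ?case by (simp add: mult_ac)
qed simp

lemma superpolynomial_decay:
  assumes z: "\<And>k. z \<in> range (R ^^ k)"
  shows "(\<lambda>n. norm ((T ^^ n) z)) \<in> o(\<lambda>n. 1 / real n ^ p)"
proof -
  \<comment> \<open>Each factor \<open>R\<close> yields order \<open>n^(-1/2)\<close>, so
    \<open>2 * Suc p\<close> of them give \<open>n^(-(p+1))\<close>, which is little-o of
    \<open>n^(-p)\<close>.\<close>
  define k where "k = 2 * Suc p"
  obtain y where y: "z = (R ^^ k) y" using z[of k] by blast
  define B where "B = (C\<^sup>2 * k) ^ Suc p * norm y"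
  have "norm ((T ^^ n) z) \<le> B * (1 / real n ^ Suc p)" if "0 < n" for n
  proof -
    define m where "m = n div k"
    have "n < k * Suc m" using dividend_less_times_div[of k n] by (simp add: m_def k_def)
    then have "real n \<le> real k * real (Suc m)"
      by (metis less_imp_le of_nat_le_iff of_nat_mult)
    then have n: "1 / real (Suc m) \<le> real k / real n"
      using that by (simp add: field_simps)
    have "norm ((T ^^ n) z) \<le> norm ((T ^^ (k * m)) z)"
      by (intro norm_T_power_mono) (simp add: m_def)
    also have "\<dots> \<le> (C / sqrt (Suc m)) ^ k * norm y"
      unfolding y by (rule norm_T_power_R_power)
    also have "(C / sqrt (Suc m)) ^ k = (C\<^sup>2 * (1 / real (Suc m))) ^ Suc p"
      unfolding k_def power_mult by (simp add: power_divide del: of_nat_Suc power_Suc)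
    also have "\<dots> * norm y \<le> (C\<^sup>2 * (real k / real n)) ^ Suc p * norm y"
      using n by (intro mult_right_mono power_mono mult_left_mono) simp_all
    also have "\<dots> = B * (1 / real n ^ Suc p)"
      by (simp only: B_def power_mult_distrib power_divide) (simp add: mult_ac)
    finally show ?thesis .
  qed
  then have "\<forall>\<^sub>F n in sequentially. norm (norm ((T ^^ n) z)) \<le> B * norm (1 / real n ^ Suc p)"
    by (intro eventually_mono[OF eventually_gt_at_top[of 0]]) simp
  then have "(\<lambda>n. norm ((T ^^ n) z)) \<in> O(\<lambda>n. 1 / real n ^ Suc p)" by (rule bigoI)
  also have "(\<lambda>n. 1 / real n ^ Suc p) \<in> o(\<lambda>n. 1 / real n ^ p)"
  proof (rule smalloI_tendsto)
    have "(\<lambda>n. 1 / real n) \<longlonglongrightarrow> 0" by (rule lim_1_over_n)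
    moreover have "\<forall>\<^sub>F n in sequentially. 1 / real n = 1 / real n ^ Suc p / (1 / real n ^ p)"
      using eventually_gt_at_top[of 0] by eventually_elim simp
    ultimately show "(\<lambda>n. 1 / real n ^ Suc p / (1 / real n ^ p)) \<longlonglongrightarrow> 0"
      by (rule Lim_transform_eventually)
    show "\<forall>\<^sub>F n in sequentially. 1 / real n ^ p \<noteq> 0"
      using eventually_gt_at_top[of 0] by eventually_elim simp
  qed
  finally show ?thesis .
qed

end

text \<open>Isolates what reflexivity supplies, namely the splitting into \<open>Fix T\<close> and
  \<open>Z\<close>.\<close>

locale decomposed_averaged_operator = averaged_operator +
  assumes decomposition: "direct_sum_decomposition (Fix T) Z"
begin

section \<open>The limit projection and the rates in terms of it\<close>

definition P\<^sub>T :: "'a \<Rightarrow> 'a" where "P\<^sub>T = projection_along (Fix T) Z"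

lemma P_T_eq: "a \<in> Fix T \<Longrightarrow> b \<in> Z \<Longrightarrow> P\<^sub>T (a + b) = a"
proof -
  assume ab: "a \<in> Fix T" "b \<in> Z"
  have "a' = a" if a': "a' \<in> Fix T \<and> a + b - a' \<in> Z" for a'
  proof -
    have "(a + b - a') - b \<in> Z"
      by (rule complex_vector.subspace_diff[OF csubspace_Z _ ab(2)]) (use a' in simp)
    then have "a - a' \<in> Z" by simp
    moreover have "a - a' \<in> Fix T"
      by (rule complex_vector.subspace_diff[OF csubspace_Fix ab(1)]) (use a' in simp)
    ultimately have "a - a' \<in> Fix T \<inter> Z" by (rule IntI[rotated])
    then show ?thesis unfolding Fix_Int_Z by simp
  qed
  then show ?thesis
    unfolding P\<^sub>T_def projection_along_def using ab by (intro the_equality) auto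
qed

lemma P_T: "P\<^sub>T x \<in> Fix T" "x - P\<^sub>T x \<in> Z"
proof -
  obtain a b where ab: "a \<in> Fix T" "b \<in> Z" "x = a + b"
    using decomposition unfolding direct_sum_decomposition_def by blast
  then have "P\<^sub>T x = a" by (simp add: P_T_eq)
  with ab show "P\<^sub>T x \<in> Fix T" "x - P\<^sub>T x \<in> Z" by simp_all
qed

lemma P_T_Z: "z \<in> Z \<Longrightarrow> P\<^sub>T z = 0"
  using P_T_eq[of 0 z] csubspace_Fix by (simp add: csubspace_iff)

lemma T_power_minus_P_T: "(T ^^ n) x - P\<^sub>T x = (T ^^ n) (x - P\<^sub>T x)"
  by (simp add: Tn.diff T_power_Fix[OF P_T(1)])

lemma T_power_tendsto_P_T: "(\<lambda>n. (T ^^ n) x - P\<^sub>T x) \<longlonglongrightarrow> 0"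
  unfolding T_power_minus_P_T by (rule T_power_tendsto_0[OF P_T(2)])

lemma norm_P_T: "norm (P\<^sub>T x) \<le> norm x"
proof -
  have "(\<lambda>n. (T ^^ n) x) \<longlonglongrightarrow> P\<^sub>T x" by (rule LIM_zero_cancel[OF T_power_tendsto_P_T])
  then show ?thesis by (rule Lim_bounded[OF tendsto_norm]) (simp add: norm_T_power)
qed

lemma orthoprojection_P_T: "orthoprojection P\<^sub>T"
proof -
  have add: "P\<^sub>T (x + y) = P\<^sub>T x + P\<^sub>T y" for x y
  proof -
    have "P\<^sub>T x + P\<^sub>T y \<in> Fix T" using P_T(1) csubspace_Fix by (simp add: csubspace_iff)
    moreover have "(x - P\<^sub>T x) + (y - P\<^sub>T y) \<in> Z" using P_T(2) csubspace_Z by (simp add: csubspace_iff)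
    ultimately have "P\<^sub>T ((P\<^sub>T x + P\<^sub>T y) + ((x - P\<^sub>T x) + (y - P\<^sub>T y))) = P\<^sub>T x + P\<^sub>T y" by (rule P_T_eq)
    then show ?thesis by (simp add: algebra_simps)
  qed
  have scale: "P\<^sub>T (c *\<^sub>C x) = c *\<^sub>C P\<^sub>T x" for c x
  proof -
    have "c *\<^sub>C P\<^sub>T x \<in> Fix T" using P_T(1) csubspace_Fix by (simp add: csubspace_iff)
    moreover have "c *\<^sub>C (x - P\<^sub>T x) \<in> Z" using P_T(2) csubspace_Z by (simp add: csubspace_iff)
    ultimately have "P\<^sub>T (c *\<^sub>C P\<^sub>T x + c *\<^sub>C (x - P\<^sub>T x)) = c *\<^sub>C P\<^sub>T x" by (rule P_T_eq)
    then show ?thesis by (simp flip: scaleC_add_right)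
  qed
  have "bounded_linear P\<^sub>T"
    using add scale norm_P_T by (intro bounded_linear_intro[where K = 1]) (simp_all add: scaleR_scaleC)
  then have "bounded_clinear P\<^sub>T" by (simp add: bounded_clinear_def scale)
  moreover have "P\<^sub>T (P\<^sub>T x) = P\<^sub>T x" for x
    using P_T_eq[of "P\<^sub>T x" 0] P_T(1) csubspace_Z by (simp add: csubspace_iff)
  moreover have "onorm P\<^sub>T \<le> 1" by (rule onorm_bound) (simp_all add: norm_P_T)
  ultimately show ?thesis by (simp add: orthoprojection_def projection_def fun_eq_iff)
qed

lemma exponentially_fast:
  assumes "closed (range R)"
  shows "\<exists>K r. 0 < K \<and> 0 \<le> r \<and> r < 1 \<and> (\<forall>n. onorm (\<lambda>x. (T ^^ n) x - P\<^sub>T x) \<le> K * r ^ n)"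
proof -
  obtain r where r: "0 \<le> r" "r < 1" "\<And>n z. z \<in> Z \<Longrightarrow> norm ((T ^^ n) z) \<le> 2 * r ^ n * norm z"
    by (rule exponential_decay_on_Z[OF assms]) blast
  have "norm ((T ^^ n) x - P\<^sub>T x) \<le> 4 * r ^ n * norm x" for n x
  proof -
    have "norm ((T ^^ n) x - P\<^sub>T x) \<le> 2 * r ^ n * norm (x - P\<^sub>T x)"
      unfolding T_power_minus_P_T by (rule r(3)[OF P_T(2)])
    also have "\<dots> \<le> 2 * r ^ n * (2 * norm x)"
      using norm_triangle_ineq4[of x "P\<^sub>T x"] norm_P_T[of x] r(1) by (intro mult_left_mono) simp_all
    finally show ?thesis by simp
  qed
  then have "onorm (\<lambda>x. (T ^^ n) x - P\<^sub>T x) \<le> 4 * r ^ n" for n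
    using r(1) by (intro onorm_bound) simp_all
  then show ?thesis using r(1,2) by (intro exI[of _ 4] exI[of _ r]) simp
qed

text \<open>\<open>R\<close> kills the \<open>Fix T\<close> component, so only the \<open>Z\<close>
  component matters.\<close>

lemma range_R_eq: "range R = R ` Z"
proof -
  have "R x = R (x - P\<^sub>T x)" for x using P_T(1)[of x] by (simp add: R.diff Fix_iff_R)
  then show ?thesis using P_T(2) by blast
qed

text \<open>Approximate eigenvectors give slow orbits in \<open>Z\<close>, where
  \<open>P\<^sub>T\<close> vanishes. The other case is impossible: a map bounded below on the
  complete space \<open>Z\<close> has complete, hence closed, image there, and this image is
  \<open>range R\<close>.\<close>

lemma weakly_arbitrarily_slow:
  assumes "\<not> closed (range R)"
  shows "weakly_arbitrarily_slow (\<lambda>n x. (T ^^ n) x - P\<^sub>T x)"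
proof (cases rule: approximate_eigenvectors_or_bounded_below)
  case approx
  show ?thesis
    unfolding weakly_arbitrarily_slow_def
  proof (intro allI impI, elim conjE)
    fix r :: "nat \<Rightarrow> real" assume "r \<longlonglongrightarrow> 0"
    then obtain x \<phi> where "x \<in> Z" "\<phi> \<in> cdual" "\<And>n. r n \<le> Re (\<phi> ((T ^^ n) x))"
      by (rule weakly_slow_orbit[OF approx, rotated]) blast+
    then show "\<exists>x. \<exists>\<phi>\<in>cdual. \<forall>n. Re (\<phi> ((T ^^ n) x - P\<^sub>T x)) \<ge> r n"
      by (intro exI[of _ x] bexI[of _ \<phi>]) (simp_all add: P_T_Z)
  qed
next
  case (bounded_below d)
  have "subspace Z"
    using csubspace_Z by (simp add: subspace_def csubspace_iff csubspace_scaleR[OF csubspace_Z])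
  then have "complete (R ` Z)"
    using bounded_below
    by (intro complete_isometric_image[where e = d]) (simp_all add: R.bounded_linear_axioms Z_def complete_eq_closed)
  then show ?thesis using assms by (simp add: range_R_eq complete_imp_closed)
qed

text \<open>Weak slowness gives slowness after multiplying \<open>x\<close> by a bound
  \<open>K\<close> for the functional.\<close>

lemma arbitrarily_slow:
  assumes "\<not> closed (range R)"
  shows "arbitrarily_slow (\<lambda>n x. (T ^^ n) x - P\<^sub>T x)"
  unfolding arbitrarily_slow_def
proof (intro allI impI)
  fix r :: "nat \<Rightarrow> real" assume "(\<forall>n. 0 \<le> r n) \<and> r \<longlonglongrightarrow> 0"
  then obtain x \<phi> where x: "\<phi> \<in> cdual" "\<And>n. r n \<le> Re (\<phi> ((T ^^ n) x - P\<^sub>T x))"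
    using weakly_arbitrarily_slow[OF assms] unfolding weakly_arbitrarily_slow_def by blast
  interpret \<phi>: bounded_linear \<phi> by (rule bounded_linear_cdual[OF x(1)])
  interpret P: bounded_linear P\<^sub>T
    using orthoprojection_P_T
    by (simp add: orthoprojection_def projection_def bounded_clinear_bounded_linear)
  obtain K where K: "0 < K" "\<And>v. norm (\<phi> v) \<le> norm v * K" using \<phi>.pos_bounded by blast
  have "r n \<le> norm ((T ^^ n) (K *\<^sub>R x) - P\<^sub>T (K *\<^sub>R x))" for n
  proof -
    have "r n \<le> norm ((T ^^ n) x - P\<^sub>T x) * K"
      using x(2)[of n] complex_Re_le_cmod[of "\<phi> ((T ^^ n) x - P\<^sub>T x)"]
        K(2)[of "(T ^^ n) x - P\<^sub>T x"] by linarith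
    also have "\<dots> = norm (K *\<^sub>R ((T ^^ n) x - P\<^sub>T x))" using K(1) by simp
    also have "K *\<^sub>R ((T ^^ n) x - P\<^sub>T x) = (T ^^ n) (K *\<^sub>R x) - P\<^sub>T (K *\<^sub>R x)"
      by (simp add: Tn.scaleR P.scaleR scaleR_diff_right)
    finally show ?thesis .
  qed
  then show "\<exists>x. \<forall>n. norm ((T ^^ n) x - P\<^sub>T x) \<ge> r n" by blast
qed

text \<open>A Mittag-Leffler argument: \<open>R\<close> maps \<open>Z\<close> onto a dense subspace of \<open>Z\<close>, so a backward
  orbit of \<open>R\<close> can be built approximately, starting at any \<open>z\<close>, and then corrected in the limit.\<close>

lemma Inter_range_R_power_dense:
  assumes z: "z \<in> Z" and e: "0 < e"
  obtains w where "\<And>k. w \<in> range (R ^^ k)" "norm (w - z) \<le> e"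
proof -
  \<comment> \<open>The factors \<open>(1 / 2) ^ Suc k\<close> make the errors sum to
    \<open>e\<close>; the factor \<open>(1 / 2) ^ k\<close> absorbs the bound \<open>2 ^ k\<close>
    for the norm of \<open>R ^^ k\<close>.\<close>
  define d where "d k = e * (1 / 2) ^ Suc k * (1 / 2) ^ k" for k
  have d_pos: "0 < d k" for k using e by (simp add: d_def)
  have "\<exists>s. \<forall>k. (s k \<in> Z \<and> (k = 0 \<longrightarrow> s k = z)) \<and> norm (R (s (Suc k)) - s k) \<le> d k"
  proof (rule dependent_nat_choice)
    show "\<exists>x. x \<in> Z \<and> (0 = (0 :: nat) \<longrightarrow> x = z)" using z by blast
  next
    fix v and k :: nat assume "v \<in> Z \<and> (k = 0 \<longrightarrow> v = z)"
    then obtain y where y: "y \<in> range R" "dist y v < d k"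
      using d_pos unfolding Z_def closure_approachable by blast
    then obtain v' where "v' \<in> Z" "y = R v'" unfolding range_R_eq by blast
    with y show "\<exists>v'. (v' \<in> Z \<and> (Suc k = 0 \<longrightarrow> v' = z)) \<and> norm (R v' - v) \<le> d k"
      by (intro exI[of _ v']) (simp add: dist_norm)
  qed
  then obtain s where s: "s 0 = z" "\<And>k. norm (R (s (Suc k)) - s k) \<le> d k" by blast
  interpret Rn: bounded_linear "R ^^ k" for k
    by (rule bounded_clinear_bounded_linear[OF bounded_clinear_funpow[OF R_clinear]])
  have norm_R_power: "norm ((R ^^ k) v) \<le> 2 ^ k * norm v" for k v
  proof (induction k)
    case (Suc k)
    then show ?case using norm_R[of "(R ^^ k) v"] by simp
  qed simp
  \<comment> \<open>\<open>Y j\<close> approximates position \<open>j\<close> of an exact backward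
    orbit. Applying \<open>R\<close> to \<open>Y (Suc j) k\<close> gives \<open>Y j (Suc k)\<close>,
    so the limits satisfy \<open>R (w (Suc j)) = w j\<close>.\<close>
  define Y where "Y j k = (R ^^ k) (s (j + k))" for j k
  have Y_diff: "norm (Y j (Suc k) - Y j k) \<le> e * (1 / 2) ^ Suc k" for j k
  proof -
    have "Y j (Suc k) - Y j k = (R ^^ k) (R (s (Suc (j + k))) - s (j + k))"
      by (simp add: Y_def Rn.diff funpow_swap1)
    also have "norm \<dots> \<le> 2 ^ k * d (j + k)"
      by (intro order_trans[OF norm_R_power] mult_left_mono s(2)) simp
    also have "\<dots> = e * (1 / 2) ^ Suc k * ((1 / 2) ^ j * (1 / 2) ^ j)"
      by (simp add: d_def power_add power_divide)
    also have "\<dots> \<le> e * (1 / 2) ^ Suc k * 1"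
      using e by (intro mult_left_mono) (simp_all add: power_le_one flip: power_mult_distrib)
    finally show ?thesis by simp
  qed
  have "summable (\<lambda>k. e * (1 / 2 :: real) ^ Suc k)"
    using summable_mult[OF summable_geometric[of "1 / 2 :: real"], of "e / 2"] by simp
  then have "convergent (Y j)" for j
    by (rule convergent_summable_diff[where X = "Y j", OF Y_diff])
  then obtain w where w: "Y j \<longlonglongrightarrow> w j" for j unfolding convergent_def by metis
  have Rw: "R (w (Suc j)) = w j" for j
  proof (rule LIMSEQ_unique)
    show "(\<lambda>k. R (Y (Suc j) k)) \<longlonglongrightarrow> R (w (Suc j))" by (rule R.tendsto[OF w])
    show "(\<lambda>k. R (Y (Suc j) k)) \<longlonglongrightarrow> w j" using LIMSEQ_Suc[OF w[of j]] by (simp add: Y_def)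
  qed
  have "(R ^^ k) (w k) = w 0" for k
    by (induction k) (simp_all add: funpow_swap1 Rw)
  then have "w 0 \<in> range (R ^^ k)" for k by (metis rangeI)
  moreover have "norm (w 0 - z) \<le> e"
  proof -
    have "norm (Y 0 k - z) \<le> e * (1 - (1 / 2) ^ k)" for k
    proof (induction k)
      case (Suc k)
      have "norm (Y 0 (Suc k) - z) \<le> norm (Y 0 (Suc k) - Y 0 k) + norm (Y 0 k - z)"
        using norm_triangle_ineq[of "Y 0 (Suc k) - Y 0 k" "Y 0 k - z"] by simp
      with Suc Y_diff[of 0 k] show ?case by (simp add: algebra_simps)
    qed (simp add: Y_def s(1))
    moreover have "e * (1 - (1 / 2) ^ k) \<le> e" for k using e by simp
    ultimately have "norm (Y 0 k - z) \<le> e" for k using order_trans by blast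
    moreover have "(\<lambda>k. norm (Y 0 k - z)) \<longlonglongrightarrow> norm (w 0 - z)" by (intro tendsto_intros w)
    ultimately show ?thesis by (intro LIMSEQ_le_const2) blast+
  qed
  ultimately show ?thesis using that by blast
qed

lemma superpolynomially_fast:
  "\<exists>X\<^sub>0. csubspace X\<^sub>0 \<and> closure X\<^sub>0 = UNIV \<and>
    (\<forall>x\<in>X\<^sub>0. superpolynomially_fast_at (\<lambda>n x. (T ^^ n) x - P\<^sub>T x) x)"
proof -
  define I where "I = (\<Inter>k. range (R ^^ k))"
  define X\<^sub>0 where "X\<^sub>0 = {a + w |a w. a \<in> Fix T \<and> w \<in> I}"
  have I_Z: "w \<in> Z" if "w \<in> I" for w
  proof -
    have "w \<in> range (R ^^ 1)" using that unfolding I_def by blast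
    then show ?thesis using R_in_Z by auto
  qed
  have "csubspace I"
    unfolding I_def
    by (intro complex_vector.subspace_Inter ballI)
      (auto intro: csubspace_range bounded_clinear_funpow R_clinear)
  then have "csubspace X\<^sub>0"
    unfolding X\<^sub>0_def by (rule complex_vector.subspace_sums[OF csubspace_Fix])
  moreover have "x \<in> closure X\<^sub>0" for x
    unfolding closure_approachable
  proof (intro allI impI)
    fix e :: real assume "0 < e"
    then obtain w where w: "\<And>k. w \<in> range (R ^^ k)" "norm (w - (x - P\<^sub>T x)) \<le> e / 2"
      using Inter_range_R_power_dense[OF P_T(2)[of x], of "e / 2"] by auto
    have "P\<^sub>T x + w \<in> X\<^sub>0" using P_T(1) w(1) unfolding X\<^sub>0_def I_def by blast
    moreover have "dist (P\<^sub>T x + w) x < e"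
      using w(2) \<open>0 < e\<close> by (simp add: dist_norm algebra_simps)
    ultimately show "\<exists>y\<in>X\<^sub>0. dist y x < e" by blast
  qed
  moreover have "superpolynomially_fast_at (\<lambda>n x. (T ^^ n) x - P\<^sub>T x) x" if "x \<in> X\<^sub>0" for x
  proof -
    obtain a w where x: "a \<in> Fix T" "w \<in> I" "x = a + w" using \<open>x \<in> X\<^sub>0\<close> unfolding X\<^sub>0_def by blast
    then have "x - P\<^sub>T x = w" using I_Z by (simp add: P_T_eq)
    moreover have "(\<lambda>n. norm ((T ^^ n) w)) \<in> o(\<lambda>n. 1 / real n ^ p)" for p
      using x(2) unfolding I_def by (intro superpolynomial_decay) blast
    ultimately show ?thesis by (simp add: superpolynomially_fast_at_def T_power_minus_P_T)
  qed
  ultimately show ?thesis by blast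
qed

end

subsection \<open>Products and convex combinations of type-D projections\<close>

text \<open>Stated without division by \<open>1 - \<rho>\<close>, so that \<open>\<rho> = 1\<close>
  is allowed; this value belongs to the identity, that is, to the empty word.\<close>

definition averaged_with :: "real \<Rightarrow> ('a::complex_normed_vector \<Rightarrow> 'a) \<Rightarrow> bool"
  where "averaged_with \<rho> W \<longleftrightarrow>
    bounded_clinear W \<and> (\<forall>x. norm (W x - \<rho> *\<^sub>R x) \<le> (1 - \<rho>) * norm x)"

lemma averaged_with_contraction:
  assumes "averaged_with \<rho> W" "0 \<le> \<rho>"
  shows "norm (W x) \<le> norm x"
proof -
  have "norm (W x) \<le> norm (\<rho> *\<^sub>R x) + norm (W x - \<rho> *\<^sub>R x)" by (rule norm_triangle_sub)
  also have "\<dots> \<le> \<rho> * norm x + (1 - \<rho>) * norm x"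
    using assms by (simp add: averaged_with_def)
  finally show ?thesis by (simp add: algebra_simps)
qed

lemma averaged_with_id: "averaged_with 1 (\<lambda>x. x)"
  by (simp add: averaged_with_def bounded_clinear_id)

text \<open>The deviation splits as that of \<open>V\<close> applied to \<open>W x\<close>, plus
  \<open>\<rho>\<close> times that of \<open>W\<close>; contractivity of \<open>W\<close> controls
  the first part.\<close>

lemma averaged_with_compose:
  assumes V: "averaged_with \<rho> V" "0 \<le> \<rho>" "\<rho> \<le> 1" and W: "averaged_with \<sigma> W" "0 \<le> \<sigma>"
  shows "averaged_with (\<rho> * \<sigma>) (\<lambda>x. V (W x))"
  unfolding averaged_with_def
proof (intro conjI allI)
  show "bounded_clinear (\<lambda>x. V (W x))"
    using V(1) W(1) unfolding averaged_with_def by (blast intro: bounded_clinear_compose)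
  fix x
  have eq: "V (W x) - (\<rho> * \<sigma>) *\<^sub>R x = (V (W x) - \<rho> *\<^sub>R W x) + \<rho> *\<^sub>R (W x - \<sigma> *\<^sub>R x)"
    by (simp add: algebra_simps)
  have "norm (V (W x) - (\<rho> * \<sigma>) *\<^sub>R x) \<le>
      norm (V (W x) - \<rho> *\<^sub>R W x) + \<rho> * norm (W x - \<sigma> *\<^sub>R x)"
    unfolding eq
    using norm_triangle_ineq[of "V (W x) - \<rho> *\<^sub>R W x" "\<rho> *\<^sub>R (W x - \<sigma> *\<^sub>R x)"] V(2) by simp
  also have "\<dots> \<le> (1 - \<rho>) * norm x + \<rho> * ((1 - \<sigma>) * norm x)"
  proof (intro add_mono mult_left_mono)
    have "norm (V (W x) - \<rho> *\<^sub>R W x) \<le> (1 - \<rho>) * norm (W x)"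
      using V(1) by (simp add: averaged_with_def)
    also have "\<dots> \<le> (1 - \<rho>) * norm x"
      using V(3) averaged_with_contraction[OF W] by (intro mult_left_mono) simp_all
    finally show "norm (V (W x) - \<rho> *\<^sub>R W x) \<le> (1 - \<rho>) * norm x" .
  qed (use V W in \<open>simp_all add: averaged_with_def\<close>)
  finally show "norm (V (W x) - (\<rho> * \<sigma>) *\<^sub>R x) \<le> (1 - \<rho> * \<sigma>) * norm x"
    by (simp add: algebra_simps)
qed

lemma averaged_with_convex_combination:
  assumes W: "\<And>j. j \<in> J \<Longrightarrow> averaged_with (\<rho> j) (W j)"
    and c: "\<And>j. j \<in> J \<Longrightarrow> 0 \<le> c j" "(\<Sum>j\<in>J. c j) = 1"
  shows "averaged_with (\<Sum>j\<in>J. c j * \<rho> j) (\<lambda>x. \<Sum>j\<in>J. c j *\<^sub>R W j x)"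
  unfolding averaged_with_def
proof (intro conjI allI)
  show "bounded_clinear (\<lambda>x. \<Sum>j\<in>J. c j *\<^sub>R W j x)"
    using W unfolding averaged_with_def
    by (intro bounded_clinear_sum bounded_clinear_scaleR) blast
  fix x
  have "norm ((\<Sum>j\<in>J. c j *\<^sub>R W j x) - (\<Sum>j\<in>J. c j * \<rho> j) *\<^sub>R x) =
      norm (\<Sum>j\<in>J. c j *\<^sub>R (W j x - \<rho> j *\<^sub>R x))"
    by (simp add: scaleR_sum_left sum_subtractf scaleR_diff_right)
  also have "\<dots> \<le> (\<Sum>j\<in>J. c j * ((1 - \<rho> j) * norm x))"
    using W c(1) by (intro sum_norm_le) (simp add: averaged_with_def mult_left_mono)
  also have "\<dots> = ((\<Sum>j\<in>J. c j) - (\<Sum>j\<in>J. c j * \<rho> j)) * norm x"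
    by (simp add: sum_distrib_left sum_subtractf algebra_simps)
  finally show "norm ((\<Sum>j\<in>J. c j *\<^sub>R W j x) - (\<Sum>j\<in>J. c j * \<rho> j) *\<^sub>R x) \<le>
      (1 - (\<Sum>j\<in>J. c j * \<rho> j)) * norm x"
    unfolding c(2) .
qed

text \<open>Lowering the parameter moves a share of the identity into the contraction part.\<close>

lemma averaged_with_decrease:
  assumes "averaged_with \<rho> W" "\<sigma> \<le> \<rho>"
  shows "averaged_with \<sigma> W"
  unfolding averaged_with_def
proof (intro conjI allI)
  show "bounded_clinear W" using assms(1) by (simp add: averaged_with_def)
  fix x
  have "norm (W x - \<sigma> *\<^sub>R x) \<le> norm (W x - \<rho> *\<^sub>R x) + norm ((\<rho> - \<sigma>) *\<^sub>R x)"
    using norm_triangle_ineq[of "W x - \<rho> *\<^sub>R x" "(\<rho> - \<sigma>) *\<^sub>R x"] by (simp add: algebra_simps)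
  also have "\<dots> \<le> (1 - \<rho>) * norm x + (\<rho> - \<sigma>) * norm x"
    using assms by (simp add: averaged_with_def)
  finally show "norm (W x - \<sigma> *\<^sub>R x) \<le> (1 - \<sigma>) * norm x" by (simp add: algebra_simps)
qed

lemma type_D_projection_averaged:
  assumes "type_D_projection Q"
  obtains r where "0 < r" "r < 1" "averaged_with r Q"
proof -
  obtain r where r: "0 < r" "r < 1" "onorm (\<lambda>x. Q x - r *\<^sub>R x) \<le> 1 - r"
    and Q: "bounded_clinear Q"
    using assms unfolding type_D_projection_def projection_def by blast
  have bl: "bounded_linear (\<lambda>x. Q x - r *\<^sub>R x)"
    by (intro bounded_clinear_bounded_linear bounded_clinear_diff bounded_clinear_scaleR
        bounded_clinear_id Q)
  have "norm (Q x - r *\<^sub>R x) \<le> (1 - r) * norm x" for x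
    using onorm[OF bl, of x] mult_right_mono[OF r(3), of "norm x"] by simp
  then show ?thesis using that[OF r(1,2)] Q by (simp add: averaged_with_def)
qed

lemma word_product_simps:
  "word_product P [] = (\<lambda>x. x)"
  "word_product P (k # ks) = (\<lambda>x. P k (word_product P ks x))"
  by (simp_all add: word_product_def fun_eq_iff)

lemma word_product_averaged:
  assumes "\<And>k. k \<in> set ks \<Longrightarrow> type_D_projection (P k)"
  shows "\<exists>\<rho>. 0 < \<rho> \<and> \<rho> \<le> 1 \<and> averaged_with \<rho> (word_product P ks)"
  using assms
proof (induction ks)
  case Nil
  show ?case by (intro exI[of _ 1]) (simp add: word_product_simps averaged_with_id)
next
  case (Cons k ks)
  obtain \<sigma> where \<sigma>: "0 < \<sigma>" "\<sigma> \<le> 1" "averaged_with \<sigma> (word_product P ks)"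
    using Cons by auto
  obtain r where r: "0 < r" "r < 1" "averaged_with r (P k)"
    using Cons.prems[of k] by (auto elim: type_D_projection_averaged)
  have "averaged_with (r * \<sigma>) (word_product P (k # ks))"
    unfolding word_product_simps using r \<sigma> by (intro averaged_with_compose) simp_all
  moreover have "0 < r * \<sigma>" "r * \<sigma> \<le> 1" using r \<sigma> by (simp_all add: mult_le_one)
  ultimately show ?case by blast
qed

section \<open>Common fixed points of words and of their convex combinations\<close>

lemma word_product_fix:
  assumes "\<And>k. k \<in> set ks \<Longrightarrow> P k x = x"
  shows "word_product P ks x = x"
  using assms by (induction ks) (simp_all add: word_product_simps)

text \<open>Contractivity forces \<open>\<parallel>P k x\<parallel> = \<parallel>x\<parallel>\<close> one factor at a time, from the right.\<close>

lemma word_product_norm_eq: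
  assumes contraction: "\<And>k v. k \<in> set ks \<Longrightarrow> norm (P k v) \<le> norm v"
    and strict: "\<And>k v. k \<in> set ks \<Longrightarrow> norm (P k v) = norm v \<Longrightarrow> P k v = v"
    and eq: "norm (word_product P ks x) = norm x"
  shows "\<forall>k\<in>set ks. P k x = x"
  using assms
proof (induction ks)
  case (Cons k ks)
  have "norm (word_product P ks x) \<le> norm x"
    using Cons.prems(1)
  proof (induction ks)
    case (Cons l ls)
    have "norm (P l (word_product P ls x)) \<le> norm (word_product P ls x)"
      by (rule Cons.prems) simp
    moreover have "norm (word_product P ls x) \<le> norm x"
      by (rule Cons.IH) (use Cons.prems in auto)
    ultimately show ?case by (simp add: word_product_simps)
  qed (simp add: word_product_simps)
  moreover have "norm (P k (word_product P ks x)) \<le> norm (word_product P ks x)"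
    by (rule Cons.prems) simp
  \<comment> \<open>The whole word preserves the norm of \<open>x\<close>, so neither its tail nor
    its head can shrink it.\<close>
  ultimately have eq: "norm (word_product P ks x) = norm x"
    using Cons.prems(3) by (simp add: word_product_simps)
  then have fixed: "\<forall>k\<in>set ks. P k x = x"
    by (intro Cons.IH Cons.prems) simp_all
  then have "word_product P ks x = x" by (intro word_product_fix) blast
  then have "norm (P k x) = norm x" using Cons.prems(3) by (simp add: word_product_simps)
  then have "P k x = x" by (intro Cons.prems) simp_all
  with fixed show ?case by simp
qed simp

text \<open>The weighted deficits \<open>c j * (b - norm (v j))\<close> are nonnegative, and the
  triangle inequality makes their sum at most 0, so each of them vanishes.\<close>

lemma convex_combination_norm_eq:
  fixes v :: "'i \<Rightarrow> 'a::real_normed_vector"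
  assumes c: "\<And>j. j \<in> J \<Longrightarrow> 0 \<le> c j" "(\<Sum>j\<in>J. c j) = 1" and J: "finite J"
    and v: "\<And>j. j \<in> J \<Longrightarrow> norm (v j) \<le> b"
    and eq: "norm (\<Sum>j\<in>J. c j *\<^sub>R v j) = b"
    and j: "j \<in> J" "c j \<noteq> 0"
  shows "norm (v j) = b"
proof -
  have "b \<le> (\<Sum>j\<in>J. norm (c j *\<^sub>R v j))" unfolding eq[symmetric] by (rule norm_sum)
  also have "\<dots> = (\<Sum>j\<in>J. c j * norm (v j))" using c(1) by (intro sum.cong) simp_all
  finally have "(\<Sum>j\<in>J. c j * (b - norm (v j))) \<le> 0"
    by (simp add: right_diff_distrib sum_subtractf c(2) flip: sum_distrib_right)
  moreover have nonneg: "0 \<le> c j * (b - norm (v j))" if "j \<in> J" for j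
    using c(1) v that by simp
  ultimately have "(\<Sum>j\<in>J. c j * (b - norm (v j))) = 0" by (meson order_antisym sum_nonneg)
  then have "c j * (b - norm (v j)) = 0" 
    using sum_nonneg_eq_0_iff[OF J, of "\<lambda>j. c j * (b - norm (v j))"] nonneg j(1) by simp
  then show ?thesis using j(2) by simp
qed

text \<open>A fixed point attains equality in the triangle inequality, so each word of nonzero
  weight preserves its norm; hence every letter of such a word fixes it, and these letters exhaust
  \<open>K\<close>.\<close>

lemma Fix_convex_combination_word_products:
  fixes P :: "nat \<Rightarrow> 'a::complex_normed_vector \<Rightarrow> 'a" and c :: "nat \<Rightarrow> real"
  assumes P: "\<And>k. k \<in> K \<Longrightarrow> type_D_projection (P k)"
    and w: "\<And>j. j < m \<Longrightarrow> set (w j) \<subseteq> K"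
    and c: "\<And>j. j < m \<Longrightarrow> 0 \<le> c j" "(\<Sum>j<m. c j) = 1"
    and strict: "\<And>k. k \<in> K \<Longrightarrow> range (P k) = {x. norm (P k x) = norm x}"
    and used: "\<And>k. k \<in> K \<Longrightarrow> \<exists>j<m. c j \<noteq> 0 \<and> k \<in> set (w j)"
  shows "Fix (\<lambda>x. \<Sum>j<m. c j *\<^sub>R word_product P (w j) x) = (\<Inter>k\<in>K. range (P k))"
proof -
  have range: "x \<in> range (P k) \<longleftrightarrow> P k x = x" if "k \<in> K" for k x
  proof -
    have "P k \<circ> P k = P k" using P[OF that] by (simp add: type_D_projection_def projection_def)
    then have idem: "P k (P k y) = P k y" for y by (simp add: fun_eq_iff)
    show ?thesis
    proof
      assume "x \<in> range (P k)"
      then show "P k x = x" using idem by auto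
    next
      assume "P k x = x"
      then show "x \<in> range (P k)" by (rule range_eqI[OF sym])
    qed
  qed
  have contraction: "norm (P k v) \<le> norm v" if "k \<in> K" for k v
    using P[OF that] by (rule type_D_projection_averaged) (simp add: averaged_with_contraction)
  have "P k x = x" if x: "x \<in> Fix (\<lambda>x. \<Sum>j<m. c j *\<^sub>R word_product P (w j) x)" and k: "k \<in> K" for x k
  proof -
    obtain j where j: "j < m" "c j \<noteq> 0" "k \<in> set (w j)" using used[OF k] by blast
    have "norm (word_product P (w j) x) = norm x"
    proof (rule convex_combination_norm_eq[where J = "{..<m}" and c = c
          and v = "\<lambda>j. word_product P (w j) x"])
      show "norm (word_product P (w i) x) \<le> norm x" if "i \<in> {..<m}" for i
      proof -
        have "\<exists>\<rho>. 0 < \<rho> \<and> \<rho> \<le> 1 \<and> averaged_with \<rho> (word_product P (w i))"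
          using w[of i] that by (intro word_product_averaged P) auto
        then show ?thesis using averaged_with_contraction less_imp_le by blast
      qed
      show "norm (\<Sum>j<m. c j *\<^sub>R word_product P (w j) x) = norm x"
        using x by (simp add: Fix_def)
    qed (use c j in auto)
    then have "\<forall>k\<in>set (w j). P k x = x"
      using w[OF j(1)] contraction strict range
      by (intro word_product_norm_eq) blast+
    with j(3) show ?thesis by blast
  qed
  moreover have "x \<in> Fix (\<lambda>x. \<Sum>j<m. c j *\<^sub>R word_product P (w j) x)" if "\<And>k. k \<in> K \<Longrightarrow> P k x = x" for x
  proof -
    have "word_product P (w j) x = x" if "j < m" for j
      using w[OF that] \<open>\<And>k. k \<in> K \<Longrightarrow> P k x = x\<close> by (intro word_product_fix) blast
    then have "(\<Sum>j<m. c j *\<^sub>R word_product P (w j) x) = (\<Sum>j<m. c j) *\<^sub>R x"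
      by (simp add: scaleR_sum_left)
    then show ?thesis by (simp add: Fix_def c(2))
  qed
  ultimately have "x \<in> Fix (\<lambda>x. \<Sum>j<m. c j *\<^sub>R word_product P (w j) x) \<longleftrightarrow> (\<forall>k\<in>K. P k x = x)"
    for x by blast
  then show ?thesis by (simp add: set_eq_iff range cong: ball_cong)
qed

theorem theorem4p6:
  fixes P :: "nat \<Rightarrow> 'a::cbanach \<Rightarrow> 'a"
    and N m :: nat
    and c :: "nat \<Rightarrow> real"
    and w :: "nat \<Rightarrow> nat list"
    and T P\<^sub>T :: "'a \<Rightarrow> 'a"
    and Z :: "'a set"
  assumes "reflexive_space TYPE('a)"
    and "\<And>k. k \<in> {1..N} \<Longrightarrow> type_D_projection (P k)"
    and "\<And>j. j < m \<Longrightarrow> w j \<noteq> [] \<and> set (w j) \<subseteq> {1..N}"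
    and "\<And>j. j < m \<Longrightarrow> c j \<ge> 0"
    and "(\<Sum>j<m. c j) = 1"
    and "T = (\<lambda>x. \<Sum>j<m. c j *\<^sub>R word_product P (w j) x)"
    and "Z = closure (range (\<lambda>x. x - T x))"
    and "P\<^sub>T = projection_along (Fix T) Z"
  shows "direct_sum_decomposition (Fix T) Z
    \<and> orthoprojection P\<^sub>T
    \<and> (\<forall>x. (\<lambda>n. norm ((T ^^ n) x - P\<^sub>T x)) \<longlonglongrightarrow> 0)
    \<and> (closed (range (\<lambda>x. x - T x)) \<longrightarrow>
         (\<exists>C r. C > 0 \<and> 0 \<le> r \<and> r < 1 \<and>
           (\<forall>n. onorm (\<lambda>x. (T ^^ n) x - P\<^sub>T x) \<le> C * r ^ n)))
    \<and> (\<not> closed (range (\<lambda>x. x - T x)) \<longrightarrow>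
         arbitrarily_slow (\<lambda>n x. (T ^^ n) x - P\<^sub>T x) \<and>
         weakly_arbitrarily_slow (\<lambda>n x. (T ^^ n) x - P\<^sub>T x))
    \<and> (\<exists>X\<^sub>0. csubspace X\<^sub>0 \<and> closure X\<^sub>0 = UNIV \<and>
         (\<forall>x\<in>X\<^sub>0. superpolynomially_fast_at (\<lambda>n x. (T ^^ n) x - P\<^sub>T x) x))
    \<and> ((\<forall>k\<in>{1..N}. range (P k) = {x. norm (P k x) = norm x}) \<and>
         (\<forall>k\<in>{1..N}. \<exists>j<m. c j \<noteq> 0 \<and> k \<in> set (w j)) \<longrightarrow>
         Fix T = (\<Inter>k\<in>{1..N}. range (P k)))"
proof -
  have "\<exists>\<rho>. 0 < \<rho> \<and> \<rho> \<le> 1 \<and> averaged_with \<rho> (word_product P (w j))" if "j < m" for j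
    using assms(3)[OF that] by (intro word_product_averaged assms(2)) blast
  then obtain \<rho> where \<rho>: "\<And>j. j < m \<Longrightarrow> 0 < \<rho> j \<and> \<rho> j \<le> 1 \<and> averaged_with (\<rho> j) (word_product P (w j))"
    by metis
  define \<sigma> where "\<sigma> = (\<Sum>j<m. c j * \<rho> j)"
  have T: "averaged_with \<sigma> T"
    unfolding \<sigma>_def assms(6) using \<rho> assms(4,5)
    by (intro averaged_with_convex_combination) simp_all
  have nonneg: "0 \<le> c j * \<rho> j" if "j < m" for j using \<rho>[OF that] assms(4)[OF that] by simp
  have "0 < \<sigma>"
  proof -
    \<comment> \<open>The coefficients sum to 1, so one of them is nonzero and makes
      \<open>\<sigma>\<close> positive.\<close>
    obtain j where j: "j < m" "c j \<noteq> 0"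
      using assms(5) by (metis lessThan_iff sum.neutral zero_neq_one)
    then have "0 < c j * \<rho> j" using \<rho>[OF j(1)] assms(4)[OF j(1)] by simp
    then show ?thesis
      unfolding \<sigma>_def using j(1) nonneg by (intro sum_pos2[of _ j]) simp_all
  qed
  have "\<sigma> \<le> 1"
  proof -
    have "\<sigma> \<le> (\<Sum>j<m. c j * 1)"
      unfolding \<sigma>_def using \<rho> assms(4) by (intro sum_mono mult_left_mono) simp_all
    then show ?thesis using assms(5) by simp
  qed
  \<comment> \<open>Only \<open>\<sigma> \<le> 1\<close> is established, whereas
    \<open>averaged_operator\<close> demands a parameter strictly below 1; halving provides
    it.\<close>
  have "averaged_with (\<sigma> / 2) T"
    by (rule averaged_with_decrease[OF T]) (use \<open>0 < \<sigma>\<close> in simp)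
  then interpret T: averaged_operator T "\<sigma> / 2"
    using \<open>0 < \<sigma>\<close> \<open>\<sigma> \<le> 1\<close> by unfold_locales (simp_all add: averaged_with_def)
  have R: "T.R = (\<lambda>x. x - T x)" by (simp add: fun_eq_iff T.R_def)
  have Z: "Z = T.Z" unfolding T.Z_def R assms(7) by (rule refl)
  interpret T: decomposed_averaged_operator T "\<sigma> / 2"
    by unfold_locales (rule T.direct_sum_Fix_Z[OF assms(1)])
  have P_T: "P\<^sub>T = T.P\<^sub>T" unfolding T.P\<^sub>T_def assms(8) Z by (rule refl)
  have "Fix T = (\<Inter>k\<in>{1..N}. range (P k))"
    if "\<forall>k\<in>{1..N}. range (P k) = {x. norm (P k x) = norm x}"
      "\<forall>k\<in>{1..N}. \<exists>j<m. c j \<noteq> 0 \<and> k \<in> set (w j)"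
    unfolding assms(6) using assms(2-5) that
    by (intro Fix_convex_combination_word_products) blast+
  moreover have "(\<lambda>n. norm ((T ^^ n) x - P\<^sub>T x)) \<longlonglongrightarrow> 0" for x
    unfolding P_T by (rule tendsto_norm_zero[OF T.T_power_tendsto_P_T])
  ultimately show ?thesis
    using T.decomposition T.orthoprojection_P_T T.exponentially_fast T.arbitrarily_slow
      T.weakly_arbitrarily_slow T.superpolynomially_fast
    unfolding Z[symmetric] P_T[symmetric] R by blast
qed

end
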